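(* Let $p$ be an odd prime, and let $q=p^{\alpha}$ for some integer $\alpha\ge 0$. If $R$ is an integral ring of characteristic not equal to $2$ and $|R|>9$, then the following three conditions are equivalent, where in (1) and (2) one may read either "for every $n\in\mathbb{N}$" or "for some $n\in\mathbb{N}$" (all resulting statements being equivalent): (1) For every (for some) $n\in\mathbb{N}$, the ring $\mathbb{M}_n(R)$ is $(q-1)$-torsion clean. (2) For every (for some) $n\in\mathbb{N}$, the ring $\mathbb{M}_n(R)$ is weakly $(q-1)$-torsion clean. (3) $R$ is a finite field and $|R|=q$.
   Context: $\mathbb{N}$ is the set of positive integers. An integral ring is a non-zero commutative ring with $1$ having no non-trivial zero divisors. $\mathbb{M}_n(R)$ is the ring of $n\times n$ matrices over $R$. A ring $S$ is $m$-torsion clean if $m\in\mathbb{N}$, every $r\in S$ can be written as $r=u+e$ with $e\in S$, $e^2=e$, and $u\in S$ a unit with $u^m=1$, and $m$ is the minimal natural number with this property. A ring $S$ is weakly $m$-torsion clean if $m\in\mathbb{N}$, every $r\in S$ can be written as $r=u+e$ or $r=u-e$ with $e\in S$, $e^2=e$, and $u\in S$ a unit with $u^m=1$, and $m$ is the minimal natural number with this property. In particular no ring is $0$-torsion clean or weakly $0$-torsion clean. *)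

theory Defs
  imports
    "Jordan_Normal_Form.Matrix"
    "Jordan_Normal_Form.VS_Connect"
    "HOL-Computational_Algebra.Primes"
begin

definition torsion_clean_prop :: "('a, 'b) ring_scheme \<Rightarrow> nat \<Rightarrow> bool" where
  "torsion_clean_prop S m \<longleftrightarrow>
     (\<forall>r\<in>carrier S. \<exists>u\<in>Units S. \<exists>e\<in>carrier S.
        u [^]\<^bsub>S\<^esub> m = \<one>\<^bsub>S\<^esub> \<and> e \<otimes>\<^bsub>S\<^esub> e = e \<and> r = u \<oplus>\<^bsub>S\<^esub> e)"

definition weakly_torsion_clean_prop :: "('a, 'b) ring_scheme \<Rightarrow> nat \<Rightarrow> bool" where
  "weakly_torsion_clean_prop S m \<longleftrightarrow>
     (\<forall>r\<in>carrier S. \<exists>u\<in>Units S. \<exists>e\<in>carrier S.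
        u [^]\<^bsub>S\<^esub> m = \<one>\<^bsub>S\<^esub> \<and> e \<otimes>\<^bsub>S\<^esub> e = e \<and>
        (r = u \<oplus>\<^bsub>S\<^esub> e \<or> r = u \<ominus>\<^bsub>S\<^esub> e))"

text \<open>The exponent is the least \<^emph>\<open>positive\<close> one. In particular no ring is 0-torsion clean,
  although every clean ring satisfies the decomposition property for exponent 0.\<close>

definition torsion_clean :: "nat \<Rightarrow> ('a, 'b) ring_scheme \<Rightarrow> bool" where
  "torsion_clean m S \<longleftrightarrow>
     m > 0 \<and> torsion_clean_prop S m \<and> (\<forall>k>0. torsion_clean_prop S k \<longrightarrow> m \<le> k)"

definition weakly_torsion_clean :: "nat \<Rightarrow> ('a, 'b) ring_scheme \<Rightarrow> bool" where
  "weakly_torsion_clean m S \<longleftrightarrow>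
     m > 0 \<and> weakly_torsion_clean_prop S m \<and>
     (\<forall>k>0. weakly_torsion_clean_prop S k \<longrightarrow> m \<le> k)"

end

theory Submission
  imports Defs "HOL-Library.Function_Algebras"
begin

text \<open>
  Everything reduces to one statement: for \<open>R\<close> as in the theorem, the matrix ring over \<open>R\<close> of any size
  \<open>n > 0\<close> is (weakly) \<open>m\<close>-torsion clean exactly when \<open>R\<close> is finite and \<open>m = |R| - 1\<close>
  (\<open>torsion_clean_mat_iff\<close>).  It has a lower and an upper bound for the exponent.

  Lower bound.  Decompose the scalar matrix of \<open>a\<close> as \<open>u + e\<close> or \<open>u - e\<close>.  A nonzero column of \<open>e\<close> is an
  eigenvector of \<open>u\<close> for \<open>a - 1\<close> or \<open>a + 1\<close>, and if \<open>e = 0\<close> then \<open>u\<close> is scalar; hence every \<open>a\<close> has a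
  \<open>k\<close>-th root of unity among \<open>a - 1\<close>, \<open>a\<close>, \<open>a + 1\<close> (\<open>weakly_torsion_clean_scalar\<close>).  There are at most
  \<open>k\<close> roots of unity, so \<open>R\<close> is finite, and they form a subgroup \<open>H\<close> of the unit group with
  \<open>|R| \<le> 3 |H|\<close>, that is, of index at most 2.  Index 1 gives \<open>|R| - 1 = |H| \<le> k\<close>.  If the index is 2,
  let \<open>\<chi>\<close> be the character of order 2 with kernel \<open>H\<close>.  As each triple meets \<open>H\<close>, the sum of
  \<open>(1 - \<chi>(a - 1)) (1 - \<chi>(a)) (1 - \<chi>(a + 1))\<close> over all \<open>a\<close> vanishes; expanding it gives
  \<open>|R| - 3\<close> for the sum of \<open>\<chi>(a\<^sup>3 - a)\<close>.  A second moment computation bounds the square of that sum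
  by \<open>4 |R|\<close>, which forces \<open>|R| \<le> 9\<close> (\<open>positive_in_triples_imp_card_le_9\<close>).

  Upper bound.  Over a finite field with \<open>N + 1 \<ge> 5\<close> elements in which \<open>2 \<noteq> 0\<close>, an endomorphism \<open>U\<close> satisfies
  \<open>U\<^sup>N = 1\<close> as soon as its eigenvectors for nonzero eigenvalues span.  So each endomorphism \<open>T\<close> needs an
  idempotent \<open>E\<close> such that \<open>T - E\<close> is diagonalisable and invertible.  Splitting off \<open>T\<close>-invariant cyclic
  summands of maximal dimension (\<open>maximal_cyclic_pair\<close>) leaves the case of a cyclic \<open>T\<close>.  A cyclic \<open>T\<close>
  has, in a suitable basis, a bidiagonal matrix apart from one column, with a diagonal that
  may be prescribed up to its sum, the trace.  The idempotent is chosen to cut every second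
  link of the bidiagonal chain, so that \<open>T - E\<close> becomes triangular with blocks of size 2; the freedom in the
  diagonal makes the relevant eigenvalues distinct and nonzero (\<open>choose_spectrum\<close>, \<open>cyclic_block\<close>).
  The fraction field, which a finite integral domain coincides with, carries the linear algebra.
\<close>

section \<open>Characters of order two on finite fields\<close>

lemma card_square_roots_le:
  fixes c :: "'a::idom"
  shows "card {x. x\<^sup>2 = c} \<le> 2"
proof (cases "{x. x\<^sup>2 = c} = {}")
  case False
  then obtain y where "y\<^sup>2 = c" by auto
  then have "{x. x\<^sup>2 = c} \<subseteq> {y, - y}" by (auto simp: power2_eq_iff)
  then have "card {x. x\<^sup>2 = c} \<le> card {y, - y}" by (intro card_mono) auto
  also have "\<dots> \<le> 2" by (simp add: card_insert_if)
  finally show ?thesis .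
qed simp

locale sign_character =
  fixes \<chi> :: "'f::field \<Rightarrow> int"
  assumes finite_UNIV: "finite (UNIV :: 'f set)"
    and zero [simp]: "\<chi> 0 = 0"
    and sign: "x \<noteq> 0 \<Longrightarrow> \<chi> x = 1 \<or> \<chi> x = - 1"
    and mult: "\<chi> (x * y) = \<chi> x * \<chi> y"
    and nontrivial: "\<exists>x. \<chi> x = - 1"
begin

lemma finite_subset_UNIV [simp, intro]: "finite (A :: 'f set)"
  by (rule finite_subset[OF subset_UNIV finite_UNIV])

lemma one [simp]: "\<chi> 1 = 1"
  using sign[of 1] mult[of 1 1] by auto

lemma square: "x \<noteq> 0 \<Longrightarrow> \<chi> x * \<chi> x = 1"
  using sign[of x] by auto

lemma sum_shift:
  fixes F :: "'f \<Rightarrow> int"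
  shows "(\<Sum>x\<in>UNIV. F (x + c)) = (\<Sum>x\<in>UNIV. F x)"
  by (rule sum.reindex_bij_witness[of _ "\<lambda>x. x - c" "\<lambda>x. x + c"]) auto

lemma sum_scale:
  fixes F :: "'f \<Rightarrow> int"
  assumes "c \<noteq> 0"
  shows "(\<Sum>x\<in>UNIV. F (c * x)) = (\<Sum>x\<in>UNIV. F x)"
  by (rule sum.reindex_bij_witness[of _ "\<lambda>x. x / c" "\<lambda>x. c * x"]) (use assms in auto)

lemma sum_character: "(\<Sum>x\<in>UNIV. \<chi> x) = 0"
proof -
  obtain z where z: "\<chi> z = - 1" using nontrivial by blast
  then have "z \<noteq> 0" by auto
  then have "(\<Sum>x\<in>UNIV. \<chi> x) = (\<Sum>x\<in>UNIV. \<chi> (z * x))" by (rule sum_scale[symmetric])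
  also have "\<dots> = - (\<Sum>x\<in>UNIV. \<chi> x)" by (simp add: mult z sum_negf)
  finally show ?thesis by simp
qed

text \<open>For \<open>x \<noteq> y\<close> and \<open>d = x - c\<close>, \<open>z = y - x\<close>, the summand is \<open>\<chi>(d) \<chi>(d + z) = \<chi>(1 + z/d)\<close>, and
  \<open>1 + z/d\<close> runs through everything but \<open>1\<close>; the full character sum is \<open>0\<close>.\<close>

lemma quadratic_sum:
  "(\<Sum>c\<in>UNIV. \<chi> (x - c) * \<chi> (y - c)) = (if x = y then int (card (UNIV :: 'f set)) else 0) - 1"
proof -
  have inv: "(\<Sum>c\<in>UNIV. \<chi> (x - c) * \<chi> (y - c)) = (\<Sum>d\<in>UNIV. \<chi> d * \<chi> (d + (y - x)))"
    by (rule sum.reindex_bij_witness[of _ "\<lambda>d. x - d" "\<lambda>c. x - c"]) (auto simp: algebra_simps)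
  also have "\<dots> = (\<Sum>d\<in>UNIV - {0}. \<chi> d * \<chi> (d + (y - x)))"
    by (rule sum.mono_neutral_right) auto
  also have "\<dots> = (if x = y then int (card (UNIV :: 'f set)) else 0) - 1"
  proof (cases "x = y")
    case True
    then have "(\<Sum>d\<in>UNIV - {0}. \<chi> d * \<chi> (d + (y - x))) = (\<Sum>d\<in>UNIV - {0::'f}. 1)"
      by (intro sum.cong) (auto simp: square)
    also have "\<dots> = int (card (UNIV :: 'f set)) - 1"
      using card_gt_0_iff[of "UNIV :: 'f set"] by (simp add: card_Diff_singleton of_nat_diff)
    finally show ?thesis using True by simp
  next
    case False
    define z where "z = y - x"
    have z: "z \<noteq> 0" using False by (simp add: z_def)
    have "(\<Sum>d\<in>UNIV - {0}. \<chi> d * \<chi> (d + z)) = (\<Sum>d\<in>UNIV - {0}. \<chi> (1 + z / d))"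
    proof (rule sum.cong)
      fix d :: 'f assume "d \<in> UNIV - {0}"
      then have d: "d \<noteq> 0" by simp
      then have "d + z = d * (1 + z / d)" by (simp add: field_simps)
      then have "\<chi> (d + z) = \<chi> d * \<chi> (1 + z / d)" by (metis mult)
      then show "\<chi> d * \<chi> (d + z) = \<chi> (1 + z / d)" using square[OF d] by (simp flip: mult.assoc)
    qed simp
    also have "\<dots> = (\<Sum>u\<in>UNIV - {1}. \<chi> u)"
      by (rule sum.reindex_bij_witness[of _ "\<lambda>u. z / (u - 1)" "\<lambda>d. 1 + z / d"]) (use z in auto)
    also have "\<dots> = - 1" using sum_character sum.remove[of UNIV 1 \<chi>] by simp
    finally show ?thesis using False by (simp add: z_def)
  qed
  finally show ?thesis .
qed

text \<open>The sum of \<open>\<chi>(a\<^sup>3 - c a)\<close>: for \<open>c \<noteq> 0\<close>, up to sign, the trace of Frobenius of the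
  elliptic curve \<open>y\<^sup>2 = a\<^sup>3 - c a\<close>.\<close>

definition cubic_sum :: "'f \<Rightarrow> int" where
  "cubic_sum c = (\<Sum>a\<in>UNIV. \<chi> a * \<chi> (a\<^sup>2 - c))"

text \<open>Substituting \<open>a = t b\<close> multiplies the sum by \<open>\<chi>(t)\<^sup>3 = \<plusminus>1\<close> (a quadratic twist).  Hence the value
  at \<open>1\<close> recurs up to sign at every nonzero square, which turns a mean square bound into a pointwise one.\<close>

lemma cubic_sum_square:
  assumes t: "t \<noteq> 0"
  shows "(cubic_sum (t\<^sup>2))\<^sup>2 = (cubic_sum 1)\<^sup>2"
proof -
  have "cubic_sum (t\<^sup>2) = (\<Sum>b\<in>UNIV. \<chi> (t * b) * \<chi> ((t * b)\<^sup>2 - t\<^sup>2))"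
    unfolding cubic_sum_def by (rule sum_scale[OF t, symmetric])
  also have "\<dots> = (\<Sum>b\<in>UNIV. \<chi> t * (\<chi> b * \<chi> (b\<^sup>2 - 1)))"
  proof (rule sum.cong)
    fix b
    have "(t * b)\<^sup>2 - t\<^sup>2 = t * (t * (b\<^sup>2 - 1))" by (simp add: power2_eq_square algebra_simps)
    then have "\<chi> ((t * b)\<^sup>2 - t\<^sup>2) = \<chi> t * \<chi> t * \<chi> (b\<^sup>2 - 1)" by (simp add: mult)
    then show "\<chi> (t * b) * \<chi> ((t * b)\<^sup>2 - t\<^sup>2) = \<chi> t * (\<chi> b * \<chi> (b\<^sup>2 - 1))"
      using square[OF t] by (simp add: mult)
  qed simp
  also have "\<dots> = \<chi> t * cubic_sum 1" by (simp add: cubic_sum_def sum_distrib_left)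
  finally show ?thesis using square[OF t] by (simp add: power_mult_distrib power2_eq_square)
qed

text \<open>Expanding the square and summing over \<open>c\<close> first makes the inner sum a case of
  \<open>quadratic_sum\<close>, so that only pairs with \<open>a\<^sup>2 = b\<^sup>2\<close> survive, at most two \<open>b\<close> for each \<open>a \<noteq> 0\<close>.\<close>

lemma cubic_sum_second_moment:
  defines "q \<equiv> int (card (UNIV :: 'f set))"
  shows "(\<Sum>c\<in>UNIV. (cubic_sum c)\<^sup>2) \<le> 2 * q * (q - 1)"
proof -
  have q: "q \<ge> 1" using card_gt_0_iff[of "UNIV :: 'f set"] by (simp add: q_def)
  have "(\<Sum>c\<in>UNIV. (cubic_sum c)\<^sup>2)
      = (\<Sum>c\<in>UNIV. \<Sum>a\<in>UNIV. \<Sum>b\<in>UNIV. \<chi> a * \<chi> b * (\<chi> (a\<^sup>2 - c) * \<chi> (b\<^sup>2 - c)))"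
    unfolding cubic_sum_def power2_eq_square[where 'a = int] sum_product
    by (intro sum.cong refl) (simp add: ac_simps)
  also have "\<dots> = (\<Sum>a\<in>UNIV. \<Sum>c\<in>UNIV. \<Sum>b\<in>UNIV. \<chi> a * \<chi> b * (\<chi> (a\<^sup>2 - c) * \<chi> (b\<^sup>2 - c)))"
    by (rule sum.swap)
  also have "\<dots> = (\<Sum>a\<in>UNIV. \<Sum>b\<in>UNIV. \<Sum>c\<in>UNIV. \<chi> a * \<chi> b * (\<chi> (a\<^sup>2 - c) * \<chi> (b\<^sup>2 - c)))"
    by (intro sum.cong refl sum.swap)
  also have "\<dots> = (\<Sum>a\<in>UNIV. \<Sum>b\<in>UNIV. \<chi> a * \<chi> b * ((if a\<^sup>2 = b\<^sup>2 then q else 0) - 1))"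
    by (simp only: sum_distrib_left[symmetric] quadratic_sum q_def)
  also have "\<dots> = (\<Sum>a\<in>UNIV. \<Sum>b\<in>UNIV. if a\<^sup>2 = b\<^sup>2 then q * (\<chi> a * \<chi> b) else 0)
      - (\<Sum>a\<in>UNIV. \<Sum>b\<in>UNIV. \<chi> a * \<chi> b)"
    unfolding sum_subtractf[symmetric] by (intro sum.cong refl) (simp add: algebra_simps)
  also have "(\<Sum>a\<in>UNIV. \<Sum>b\<in>UNIV. \<chi> a * \<chi> b) = 0"
    unfolding sum_product[symmetric] by (simp add: sum_character)
  also have "(\<Sum>a\<in>UNIV. \<Sum>b\<in>UNIV. if a\<^sup>2 = b\<^sup>2 then q * (\<chi> a * \<chi> b) else 0)
      = (\<Sum>a\<in>UNIV - {0}. \<Sum>b\<in>UNIV. if a\<^sup>2 = b\<^sup>2 then q * (\<chi> a * \<chi> b) else 0)"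
    by (rule sum.mono_neutral_right) (auto intro!: sum.neutral)
  also have "\<dots> \<le> (\<Sum>a\<in>UNIV - {0::'f}. 2 * q)"
  proof (rule sum_mono)
    fix a :: 'f
    have le1: "\<chi> a * \<chi> b \<le> 1" for b
      using sign[of a] sign[of b] by (cases "a = 0"; cases "b = 0") auto
    have "(\<Sum>b\<in>UNIV. if a\<^sup>2 = b\<^sup>2 then q * (\<chi> a * \<chi> b) else 0)
        \<le> (\<Sum>b\<in>UNIV. if a\<^sup>2 = b\<^sup>2 then q else 0)"
      using q le1 by (intro sum_mono) (auto simp: mult_le_cancel_left1)
    also have "\<dots> = int (card {b. b\<^sup>2 = a\<^sup>2}) * q"
    proof -
      have "{b. a\<^sup>2 = b\<^sup>2} = {b. b\<^sup>2 = a\<^sup>2}" by auto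
      then show ?thesis by (simp add: sum.If_cases)
    qed
    also have "\<dots> \<le> 2 * q" using card_square_roots_le[of "a\<^sup>2"] q by (intro mult_right_mono) auto
    finally show "(\<Sum>b\<in>UNIV. if a\<^sup>2 = b\<^sup>2 then q * (\<chi> a * \<chi> b) else 0) \<le> 2 * q" .
  qed
  also have "\<dots> = 2 * q * (q - 1)"
    using q by (simp add: q_def card_Diff_singleton of_nat_diff)
  finally show ?thesis by simp
qed

text \<open>The Hasse bound for this family of curves: among the \<open>q - 1\<close> values \<open>t\<^sup>2\<close> each \<open>c\<close> occurs at most
  twice, so \<open>(q - 1) S\<^sup>2\<close> is at most twice the second moment.\<close>

lemma cubic_sum_bound:
  defines "q \<equiv> int (card (UNIV :: 'f set))"
  assumes q: "q > 1"
  shows "(cubic_sum 1)\<^sup>2 \<le> 4 * q"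
proof -
  have "(q - 1) * (cubic_sum 1)\<^sup>2 = (\<Sum>t\<in>UNIV - {0}. (cubic_sum (t\<^sup>2))\<^sup>2)"
    using q by (simp add: cubic_sum_square q_def card_Diff_singleton of_nat_diff)
  also have "\<dots> \<le> (\<Sum>t\<in>UNIV. (cubic_sum (t\<^sup>2))\<^sup>2)" by (intro sum_mono2) auto
  also have "\<dots> = (\<Sum>t\<in>UNIV. \<Sum>c\<in>UNIV. if t\<^sup>2 = c then (cubic_sum c)\<^sup>2 else 0)" by simp
  also have "\<dots> = (\<Sum>c\<in>UNIV. \<Sum>t\<in>UNIV. if t\<^sup>2 = c then (cubic_sum c)\<^sup>2 else 0)" by (rule sum.swap)
  also have "\<dots> \<le> (\<Sum>c\<in>UNIV. 2 * (cubic_sum c)\<^sup>2)"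
  proof (rule sum_mono)
    fix c
    have "(\<Sum>t\<in>UNIV. if t\<^sup>2 = c then (cubic_sum c)\<^sup>2 else 0) = int (card {t. t\<^sup>2 = c}) * (cubic_sum c)\<^sup>2"
      by (simp add: sum.If_cases)
    also have "\<dots> \<le> 2 * (cubic_sum c)\<^sup>2"
      using card_square_roots_le[of c] by (intro mult_right_mono) auto
    finally show "(\<Sum>t\<in>UNIV. if t\<^sup>2 = c then (cubic_sum c)\<^sup>2 else 0) \<le> 2 * (cubic_sum c)\<^sup>2" .
  qed
  also have "\<dots> \<le> (q - 1) * (4 * q)"
    using cubic_sum_second_moment by (simp add: q_def algebra_simps flip: sum_distrib_left)
  finally show ?thesis using q by simp
qed

text \<open>The hypothesis annihilates the sum of \<open>(1 - \<chi>(a - 1)) (1 - \<chi>(a)) (1 - \<chi>(a + 1))\<close>, so the cubic sum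
  equals \<open>q - 3\<close>; and \<open>(q - 3)\<^sup>2 \<le> 4 q\<close> means \<open>(q - 1) (q - 9) \<le> 0\<close>.\<close>

lemma positive_in_triples_imp_card_le_9:
  assumes two: "(2::'f) \<noteq> 0"
    and triple: "\<And>a. \<chi> (a - 1) = 1 \<or> \<chi> a = 1 \<or> \<chi> (a + 1) = 1"
  shows "card (UNIV :: 'f set) \<le> 9"
proof (rule ccontr)
  define q where "q = int (card (UNIV :: 'f set))"
  assume "\<not> ?thesis"
  then have q: "q > 9" by (simp add: q_def)
  have s1: "(\<Sum>a\<in>UNIV. \<chi> (a - 1)) = 0" "(\<Sum>a\<in>UNIV. \<chi> (a + 1)) = 0"
    using sum_shift[of \<chi> "- 1"] sum_shift[of \<chi> 1] sum_character by simp_all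
  have neg: "(\<Sum>a\<in>UNIV. \<chi> (a + x) * \<chi> (a + y)) = - 1" if "x \<noteq> y" for x y
  proof -
    have "(\<Sum>a\<in>UNIV. \<chi> (a + x) * \<chi> (a + y)) = (\<Sum>c\<in>UNIV. \<chi> (x - c) * \<chi> (y - c))"
      by (rule sum.reindex_bij_witness[of _ uminus uminus]) (auto simp: add.commute)
    then show ?thesis using that by (simp add: quadratic_sum)
  qed
  have "(1::'f) \<noteq> - 1" using two by (metis add.right_inverse one_add_one)
  then have s2: "(\<Sum>a\<in>UNIV. \<chi> a * \<chi> (a - 1)) = - 1" "(\<Sum>a\<in>UNIV. \<chi> a * \<chi> (a + 1)) = - 1"
    "(\<Sum>a\<in>UNIV. \<chi> (a - 1) * \<chi> (a + 1)) = - 1"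
    using neg[of 0 "- 1"] neg[of 0 1] neg[of "- 1" 1] by simp_all
  have s3: "(\<Sum>a\<in>UNIV. \<chi> a * (\<chi> (a - 1) * \<chi> (a + 1))) = cubic_sum 1"
    unfolding cubic_sum_def
    by (intro sum.cong refl) (simp add: power2_eq_square algebra_simps flip: mult)
  have "0 = (\<Sum>a\<in>UNIV. (1 - \<chi> (a - 1)) * (1 - \<chi> a) * (1 - \<chi> (a + 1)))"
    using triple by (intro sum.neutral[symmetric]) auto
  also have "\<dots> = (\<Sum>a\<in>(UNIV::'f set). 1 - \<chi> a - \<chi> (a - 1) - \<chi> (a + 1) + \<chi> a * \<chi> (a - 1)
      + \<chi> a * \<chi> (a + 1) + \<chi> (a - 1) * \<chi> (a + 1) - \<chi> a * (\<chi> (a - 1) * \<chi> (a + 1)))"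
    by (intro sum.cong refl) (simp add: algebra_simps)
  also have "\<dots> = q - 3 - cubic_sum 1"
    by (simp add: sum.distrib sum_subtractf s1 s2 s3 sum_character q_def)
  finally have "cubic_sum 1 = q - 3" by simp
  then have "(q - 3)\<^sup>2 \<le> 4 * q" using cubic_sum_bound q by (simp add: q_def)
  moreover have "(q - 3)\<^sup>2 - 4 * q = (q - 1) * (q - 9)" by (simp add: power2_eq_square algebra_simps)
  moreover have "(q - 1) * (q - 9) > 0" using q by simp
  ultimately show False by linarith
qed

end

section \<open>Roots of unity that meet every triple of consecutive elements\<close>

lemma card_roots_of_unity_le:
  fixes k :: nat
  assumes "k > 0"
  shows "finite {x::'a::idom. x ^ k = 1}" "card {x::'a. x ^ k = 1} \<le> k"
proof -
  define p where "p = monom (1::'a) k + (- 1)"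
  have deg: "degree p = k"
    unfolding p_def using assms by (subst degree_add_eq_left) (auto simp: degree_monom_eq)
  then have "p \<noteq> 0" using assms by auto
  moreover have "{x. x ^ k = 1} = {x. poly p x = 0}" by (simp add: p_def poly_monom)
  ultimately show "finite {x::'a. x ^ k = 1}" "card {x::'a. x ^ k = 1} \<le> k"
    using poly_roots_finite[of p] card_poly_roots_bound[of p] deg by simp_all
qed

text \<open>Three translates of the group \<open>H\<close> of roots of unity cover the field, which leaves no room for three
  cosets of \<open>H\<close> and the element \<open>0\<close>; index 2 is excluded by the character with kernel \<open>H\<close>.\<close>

lemma triple_exponent_ge:
  fixes k :: nat
  assumes finite: "finite (UNIV :: 'f::field set)" and two: "(2::'f) \<noteq> 0" and card: "card (UNIV :: 'f set) > 9" and k: "k > 0"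
    and triple: "\<And>a::'f. a ^ k = 1 \<or> (a - 1) ^ k = 1 \<or> (a + 1) ^ k = 1"
  shows "card (UNIV :: 'f set) - 1 \<le> k"
proof -
  define H where "H = {x::'f. x ^ k = 1}"
  have fin: "finite A" for A :: "'f set" by (rule finite_subset[OF subset_UNIV finite])
  have H1: "1 \<in> H" and H0: "0 \<notin> H" using k by (auto simp: H_def zero_power)
  have Hm: "x * y \<in> H \<longleftrightarrow> y \<in> H" if "x \<in> H" for x y
    using that by (simp add: H_def power_mult_distrib)
  have "UNIV \<subseteq> H \<union> (\<lambda>x. x + 1) ` H \<union> (\<lambda>x. x - 1) ` H"
  proof
    fix a :: 'f
    have "a = (a - 1) + 1" "a = (a + 1) - 1" by simp_all
    then show "a \<in> H \<union> (\<lambda>x. x + 1) ` H \<union> (\<lambda>x. x - 1) ` H"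
      using triple[of a] unfolding H_def by blast
  qed
  then have "card (UNIV::'f set) \<le> card (H \<union> (\<lambda>x. x + 1) ` H \<union> (\<lambda>x. x - 1) ` H)"
    by (rule card_mono[OF fin])
  also have "\<dots> \<le> card H + card ((\<lambda>x. x + 1) ` H) + card ((\<lambda>x. x - 1) ` H)"
    by (meson add_mono card_Un_le le_trans order_refl)
  also have "\<dots> \<le> 3 * card H"
    using card_image_le[OF fin, of "\<lambda>x. x + 1" H] card_image_le[OF fin, of "\<lambda>x. x - 1" H] by simp
  finally have big: "card (UNIV::'f set) \<le> 3 * card H" .
  have coset: "card ((*) x ` H) = card H" if "x \<noteq> 0" for x
    using that by (intro card_image) (auto simp: inj_on_def)
  have "H = UNIV - {0}"
  proof (rule ccontr)
    assume neq: "H \<noteq> UNIV - {0}"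
    then obtain z where z: "z \<noteq> 0" "z \<notin> H" using H0 by blast
    have zdisj: "z * y \<notin> H" if "y \<in> H" for y
      using Hm[OF that, of z] z(2) by (simp add: mult.commute)
    have disj: "H \<inter> (*) z ` H = {}" using zdisj by auto
    have cover: "x \<in> H \<union> (*) z ` H" if x: "x \<noteq> 0" for x
    proof (rule ccontr)
      assume nx: "x \<notin> H \<union> (*) z ` H"
      have "x * y \<notin> H \<union> (*) z ` H" if y: "y \<in> H" for y
      proof
        assume "x * y \<in> H \<union> (*) z ` H"
        then show False
        proof
          assume "x * y \<in> H"
          then show False using nx Hm[OF y, of x] by (simp add: mult.commute)
        next
          assume "x * y \<in> (*) z ` H"
          then obtain w where w: "w \<in> H" "x * y = z * w" by auto
          have y0: "y \<noteq> 0" using y H0 by auto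
          have "y * (w / y) \<in> H" using w(1) y0 by simp
          then have "w / y \<in> H" using Hm[OF y] by blast
          moreover have "x = z * (w / y)" using w(2) y0 by (simp add: field_simps)
          ultimately show False using nx by blast
        qed
      qed
      \<comment> \<open>A third coset would give \<open>3 |H| \<le> |F| - 1\<close>, against the covering by three translates.\<close>
      then have d2: "(H \<union> (*) z ` H) \<inter> (*) x ` H = {}" by auto
      have "3 * card H = card (H \<union> (*) z ` H \<union> (*) x ` H)"
        using disj d2 coset[OF x] coset[OF z(1)] by (simp add: card_Un_disjoint fin)
      also have "\<dots> \<le> card (UNIV - {0::'f})"
        using H0 x z(1) by (intro card_mono[OF fin]) auto
      also have "\<dots> < card (UNIV :: 'f set)" using card by (simp add: card_Diff_singleton)
      finally show False using big by simp
    qed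
    have zz: "z * z \<in> H"
    proof (rule ccontr)
      assume "z * z \<notin> H"
      then have "z * z \<in> (*) z ` H" using cover[of "z * z"] z(1) by auto
      then show False using z by auto
    qed
    define \<chi> :: "'f \<Rightarrow> int" where "\<chi> x = (if x = 0 then 0 else if x \<in> H then 1 else - 1)" for x
    have nn: "x * y \<in> H" if xy: "x \<notin> H" "y \<notin> H" "x \<noteq> 0" "y \<noteq> 0" for x y
    proof -
      obtain a b where ab: "a \<in> H" "x = z * a" "b \<in> H" "y = z * b"
        using cover[of x] cover[of y] xy by auto
      then have "x * y = a * (b * (z * z))" by (simp add: ac_simps)
      then show ?thesis using Hm[OF ab(1)] Hm[OF ab(3)] zz by simp
    qed
    interpret sign_character \<chi>
    proof
      show "\<chi> (x * y) = \<chi> x * \<chi> y" for x y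
        using Hm[of x y] Hm[of y x] nn[of x y] by (auto simp: \<chi>_def mult.commute)
      show "\<exists>x. \<chi> x = - 1" using z by (intro exI[of _ z]) (simp add: \<chi>_def)
    qed (auto simp: \<chi>_def finite)
    have pos: "\<chi> x = 1 \<longleftrightarrow> x ^ k = 1" for x
      using H0 by (auto simp: \<chi>_def H_def)
    have "card (UNIV :: 'f set) \<le> 9"
      by (rule positive_in_triples_imp_card_le_9[OF two]) (use triple pos in blast)
    with card show False by simp
  qed
  then have "card (UNIV :: 'f set) - 1 = card H" by (simp add: card_Diff_singleton)
  also have "\<dots> \<le> k" unfolding H_def by (rule card_roots_of_unity_le(2)[OF k])
  finally show ?thesis .
qed

text \<open>Multiplication by \<open>a\<close> permutes the nonzero elements, so it preserves their product.\<close>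

lemma finite_field_power:
  fixes a :: "'f::field"
  assumes fin: "finite (UNIV :: 'f set)" and "a \<noteq> 0"
  shows "a ^ (card (UNIV :: 'f set) - 1) = 1"
proof -
  let ?S = "UNIV - {0 :: 'f}"
  have "(\<Prod>x\<in>?S. a * x) = (\<Prod>x\<in>?S. x)"
    by (rule prod.reindex_bij_witness[of _ "\<lambda>x. x / a" "\<lambda>x. a * x"]) (use assms in auto)
  then have "a ^ card ?S * (\<Prod>x\<in>?S. x) = (\<Prod>x\<in>?S. x)" by (simp add: prod.distrib)
  moreover have "(\<Prod>x\<in>?S. x) \<noteq> 0" using finite_subset[OF subset_UNIV fin] by (subst prod_zero_iff) auto
  ultimately show ?thesis by (simp add: card_Diff_singleton)
qed

section \<open>Prescribing eigenvalues on a cyclic block\<close>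

lemma alternating_sum:
  fixes a :: "'f::field"
  shows "(\<Sum>j<2*i. if even j then - a else a + 1) = of_nat i"
  by (induction i) (auto simp: algebra_simps)

text \<open>The numbers \<open>\<mu> i\<close> will be the eigenvalues of \<open>T - E\<close> on a cyclic block of dimension \<open>m + 1\<close>, the \<open>\<epsilon> i\<close> the
  diagonal entries of \<open>E\<close>, and \<open>\<tau>\<close> the trace of \<open>T\<close>.  The basis vectors with even \<open>i > 0\<close> are linked only to
  their predecessors, so their eigenvalues need only differ from those; the vector with index \<open>0\<close> may be linked to
  all others.  Eigenvalues \<open>a\<close> and \<open>- a\<close> on the pairs keep the sum under control.  What remains of the
  trace goes into \<open>\<mu> 0\<close>, and the index \<open>m\<close> offers the freedom to make \<open>\<mu> 0\<close> nonzero: for even \<open>m\<close>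
  the choice of \<open>\<epsilon> m \<in> {0, 1}\<close>, for odd \<open>m\<close> the choice of \<open>\<mu> m\<close>.\<close>

lemma choose_spectrum:
  fixes \<tau> :: "'f::field"
  assumes card: "card (UNIV :: 'f set) \<ge> 5" and two: "(2::'f) \<noteq> 0"
  obtains \<mu> \<epsilon> :: "nat \<Rightarrow> 'f" where
    "\<And>i. i \<le> m \<Longrightarrow> \<mu> i \<noteq> 0"
    "\<And>i. 0 < i \<Longrightarrow> i \<le> m \<Longrightarrow> \<mu> i \<noteq> \<mu> 0"
    "\<And>i. 0 < i \<Longrightarrow> i \<le> m \<Longrightarrow> even i \<Longrightarrow> \<mu> (i - 1) \<noteq> \<mu> i"
    "\<And>i. i \<le> m \<Longrightarrow> odd i \<Longrightarrow> \<epsilon> i = 0"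
    "\<And>i. i < m \<Longrightarrow> even i \<Longrightarrow> \<epsilon> i = 1"
    "\<epsilon> m * \<epsilon> m = \<epsilon> m"
    "(\<Sum>i\<le>m. \<mu> i + \<epsilon> i) = \<tau>"
proof -
  have avoid: "\<exists>x::'f. x \<notin> {p, q, r}" for p q r
  proof (rule ccontr)
    assume "\<not> ?thesis"
    then have "(UNIV::'f set) \<subseteq> {p, q, r}" by auto
    then have "card (UNIV :: 'f set) \<le> card {p, q, r}" by (intro card_mono) auto
    also have "\<dots> \<le> 3" by (simp add: card_insert_if)
    finally show False using card by simp
  qed
  have neg: "a \<noteq> - a" if "a \<noteq> 0" for a :: 'f
  proof
    assume "a = - a"
    then have "2 * a = 0" by (metis add.right_inverse mult_2)
    with two that show False by simp
  qed
  show thesis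
  proof (cases "even m")
    case True
    then obtain l where m: "m = 2 * l" by blast
    define e where "e = (if \<tau> - of_nat l = 0 then 1 else 0 :: 'f)"
    define d where "d = \<tau> - of_nat l - e"
    have d: "d \<noteq> 0" by (auto simp: d_def e_def)
    obtain a where a: "a \<notin> {0, d, - d}" using avoid by blast
    define \<mu> where "\<mu> i = (if i = 0 then d else if odd i then - a else a)" for i :: nat
    define \<epsilon> where "\<epsilon> i = (if odd i then 0 else 1) + (if i = m then e - 1 else 0)" for i :: nat
    have "(\<Sum>i\<le>m. \<mu> i + \<epsilon> i)
        = (\<Sum>i<Suc m. \<mu> i + (if odd i then 0 else 1)) + (\<Sum>i<Suc m. if i = m then e - 1 else 0)"
      by (simp add: \<epsilon>_def lessThan_Suc_atMost sum.distrib algebra_simps)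
    also have "(\<Sum>i<Suc m. if i = m then e - 1 else 0) = e - 1" by simp
    also have "(\<Sum>i<Suc m. \<mu> i + (if odd i then 0 else 1))
        = d + 1 + (\<Sum>j<m. \<mu> (Suc j) + (if odd (Suc j) then 0 else 1))"
      by (subst sum.lessThan_Suc_shift) (simp add: \<mu>_def)
    also have "(\<Sum>j<m. \<mu> (Suc j) + (if odd (Suc j) then 0 else 1))
        = (\<Sum>j<2*l. if even j then - a else a + 1)"
      unfolding m by (rule sum.cong) (simp_all add: \<mu>_def)
    finally have "(\<Sum>i\<le>m. \<mu> i + \<epsilon> i) = \<tau>" by (simp add: alternating_sum d_def)
    moreover have "- a \<noteq> d" using a by auto
    ultimately show thesis
      using d a neg[of a] True
      by (intro that[of \<mu> \<epsilon>]) (auto simp: \<mu>_def \<epsilon>_def e_def)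
  next
    case False
    then obtain l where m: "m = 2 * l + 1" using oddE by blast
    define t where "t = \<tau> - of_nat l - 1"
    \<comment> \<open>Avoiding \<open>t\<close> keeps \<open>t - s\<close> nonzero, avoiding \<open>t / 2\<close> keeps it different from \<open>s\<close>.\<close>
    obtain s where s: "s \<notin> {0, t, t / 2}" using avoid by blast
    define d where "d = t - s"
    have d: "d \<noteq> 0" "s \<noteq> d" using s two by (auto simp: d_def field_simps)
    obtain a where a: "a \<notin> {0, d, - d}" using avoid by blast
    define \<mu> where "\<mu> i = (if i = 0 then d else if i = m then s else if odd i then - a else a)" for i :: nat
    define \<epsilon> where "\<epsilon> i = (if odd i then 0 else 1 :: 'f)" for i :: nat
    have "(\<Sum>i\<le>m. \<mu> i + \<epsilon> i) = (\<Sum>i<Suc (Suc (2 * l)). \<mu> i + \<epsilon> i)"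
      by (simp add: m lessThan_Suc_atMost)
    also have "\<dots> = s + (\<Sum>i<Suc (2 * l). \<mu> i + \<epsilon> i)"
      by (subst sum.lessThan_Suc) (simp add: \<mu>_def \<epsilon>_def m)
    also have "(\<Sum>i<Suc (2 * l). \<mu> i + \<epsilon> i) = d + 1 + (\<Sum>j<2*l. if even j then - a else a + 1)"
    proof -
      have "(\<Sum>j<2*l. \<mu> (Suc j) + \<epsilon> (Suc j)) = (\<Sum>j<2*l. if even j then - a else a + 1)"
        by (rule sum.cong) (simp_all add: \<mu>_def \<epsilon>_def m)
      then show ?thesis by (subst sum.lessThan_Suc_shift) (simp add: \<mu>_def \<epsilon>_def m)
    qed
    finally have "(\<Sum>i\<le>m. \<mu> i + \<epsilon> i) = \<tau>" by (simp add: alternating_sum d_def t_def)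
    moreover have "- a \<noteq> d" using a by auto
    ultimately show thesis
      using d a neg[of a] s False
      by (intro that[of \<mu> \<epsilon>]) (auto simp: \<mu>_def \<epsilon>_def)
  qed
qed

section \<open>Diagonalisable endomorphisms and functionals\<close>

locale endomorphism = Vector_Spaces.linear scale scale T
  for scale :: "'f::field \<Rightarrow> 'v::ab_group_add \<Rightarrow> 'v" and T :: "'v \<Rightarrow> 'v"
begin

text \<open>Diagonalisability with spectrum in \<open>A\<close> is expressed as membership in this span, which needs
  neither a dimension nor a minimal polynomial.\<close>

definition eigenspan :: "'f set \<Rightarrow> 'v set" where
  "eigenspan A = vs1.span {x. \<exists>a\<in>A. T x = scale a x}"

lemma eigenspan_mono: "A \<subseteq> B \<Longrightarrow> eigenspan A \<subseteq> eigenspan B"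
  unfolding eigenspan_def by (intro vs1.span_mono) auto

text \<open>On the span of the eigenvectors with eigenvalues other than \<open>d\<close>, \<open>T - d\<close> is invertible; so \<open>w\<close> can be
  corrected by an element of that span to an eigenvector for \<open>d\<close>.\<close>

lemma eigenspan_extend:
  assumes w: "T w - scale d w \<in> eigenspan A" and d: "d \<notin> A"
  shows "w \<in> eigenspan (insert d A)"
proof -
  have "\<exists>z'\<in>eigenspan A. T z' - scale d z' = z" if "z \<in> eigenspan A" for z
    using that unfolding eigenspan_def
  proof (induction rule: vs1.span_induct_alt)
    case base
    then show ?case by (intro bexI[of _ 0]) (auto simp: zero vs1.span_zero)
  next
    case (step c x y)
    then obtain a y' where a: "a \<in> A" "T x = scale a x"
      and y': "y' \<in> vs1.span {x. \<exists>a\<in>A. T x = scale a x}" "T y' - scale d y' = y" by auto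
    have ad: "a \<noteq> d" using a d by auto
    let ?z = "scale (c / (a - d)) x + y'"
    have "T ?z - scale d ?z = scale (c / (a - d) * a - d * (c / (a - d))) x + y"
      by (simp add: add scale a y'(2)[symmetric] vs1.scale_right_distrib vs1.scale_left_diff_distrib mult.commute)
    also have "c / (a - d) * a - d * (c / (a - d)) = c * (a - d) / (a - d)"
      by (simp only: diff_divide_distrib right_diff_distrib) (simp add: mult.commute)
    also have "\<dots> = c" using ad by simp
    finally have "T ?z - scale d ?z = scale c x + y" .
    moreover have "?z \<in> vs1.span {x. \<exists>a\<in>A. T x = scale a x}"
      using a by (intro vs1.span_add[OF vs1.span_scale[OF vs1.span_base] y'(1)]) auto
    ultimately show ?case by blast
  qed
  with w obtain z where z: "z \<in> eigenspan A" "T z - scale d z = T w - scale d w" by blast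
  have "T (w - z) = scale d (w - z)"
    using z(2) by (simp add: diff vs1.scale_right_diff_distrib algebra_simps)
  then have "w - z \<in> eigenspan (insert d A)"
    unfolding eigenspan_def by (intro vs1.span_base) auto
  moreover have "z \<in> eigenspan (insert d A)" using z(1) eigenspan_mono[of A "insert d A"] by auto
  ultimately have "(w - z) + z \<in> eigenspan (insert d A)"
    unfolding eigenspan_def by (rule vs1.span_add)
  then show ?thesis by simp
qed

lemma linear_funpow: "Vector_Spaces.linear scale scale (T ^^ n)"
proof (induction n)
  case 0
  then show ?case using vs1.linear_id by (simp add: id_def)
next
  case (Suc n)
  then show ?case using Vector_Spaces.linear_compose[OF Suc linear_axioms] by (simp only: funpow.simps)
qed

lemma eigenspan_funpow_fixed:
  assumes A: "\<And>a. a \<in> A \<Longrightarrow> a ^ N = 1" and x: "x \<in> eigenspan A"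
  shows "(T ^^ N) x = x"
proof -
  interpret TN: Vector_Spaces.linear scale scale "T ^^ N" by (rule linear_funpow)
  from x show ?thesis unfolding eigenspan_def
  proof (induction rule: vs1.span_induct_alt)
    case base
    then show ?case by (simp add: TN.zero)
  next
    case (step c x y)
    then obtain a where a: "a \<in> A" "T x = scale a x" by auto
    have "(T ^^ n) x = scale (a ^ n) x" for n
      by (induction n) (auto simp: a scale mult.commute)
    then have "(T ^^ N) x = x" using A[OF a(1)] by simp
    then show ?case using step by (simp add: TN.add TN.scale)
  qed
qed

end

context vector_space
begin

lemma separating_functional:
  assumes "subspace Z" "x \<notin> Z"
  obtains g where "Vector_Spaces.linear scale (*) g" "g x = 1" "\<And>z. z \<in> Z \<Longrightarrow> g z = 0"
proof -
  interpret P: vector_space_pair scale "(*) :: 'a \<Rightarrow> 'a \<Rightarrow> 'a"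
    by unfold_locales (auto simp: algebra_simps)
  obtain B where B: "B \<subseteq> Z" "independent B" "Z \<subseteq> span B"
    using maximal_independent_subset[of Z] by blast
  have span: "span B = Z" using B assms(1) by (meson subset_antisym span_minimal)
  have ind: "independent (insert x B)" using assms(2) span B(2) by (intro independent_insertI) auto
  obtain g where g: "Vector_Spaces.linear scale (*) g"
      "\<forall>y\<in>insert x B. g y = (if y = x then 1 else 0)"
    using P.linear_independent_extend[OF ind, of "\<lambda>y. if y = x then 1 else 0"] by blast
  have xB: "x \<notin> B" using assms(2) B(1) by auto
  interpret g: Vector_Spaces.linear scale "(*)" g by (fact g(1))
  have gB: "g y = 0" if "y \<in> B" for y
    using bspec[OF g(2), of y] that xB by (metis insertI2)
  have "g z = 0" if "z \<in> Z" for z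
    by (rule g.eq_0_on_span[OF gB]) (use that span in auto)
  moreover have "g x = 1" using g(2) by simp
  ultimately show thesis using that[OF g(1)] by blast
qed

text \<open>Gram-Schmidt: a unitriangular family of functionals is turned into a family dual to \<open>b\<close> with the same
  common kernel.  This yields the projection onto the span of \<open>b\<close> along that kernel.\<close>

lemma dual_family:
  fixes k :: nat
  assumes h: "\<And>i. i < k \<Longrightarrow> Vector_Spaces.linear scale (*) (h i)"
    and tri: "\<And>i j. i < j \<Longrightarrow> j < k \<Longrightarrow> h i (b j) = 0"
    and diag: "\<And>i. i < k \<Longrightarrow> h i (b i) = 1"
  obtains g where "\<And>i. i < k \<Longrightarrow> Vector_Spaces.linear scale (*) (g i)"
    and "\<And>i j. i < k \<Longrightarrow> j < k \<Longrightarrow> g i (b j) = (if i = j then 1 else 0)"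
    and "\<And>u i. (\<And>i. i < k \<Longrightarrow> h i u = 0) \<Longrightarrow> i < k \<Longrightarrow> g i u = 0"
    and "\<And>u i. i < k \<Longrightarrow> h i (u - (\<Sum>j<k. scale (g j u) (b j))) = 0"
proof -
  have "\<exists>g. (\<forall>i<k. Vector_Spaces.linear scale (*) (g i)) \<and>
      (\<forall>i<k. \<forall>j<k. g i (b j) = (if i = j then 1 else 0)) \<and>
      (\<forall>u. (\<forall>i<k. h i u = 0) \<longrightarrow> (\<forall>i<k. g i u = 0)) \<and>
      (\<forall>u. \<forall>i<k. h i (u - (\<Sum>j<k. scale (g j u) (b j))) = 0)"
    using assms
  proof (induction k)
    case 0
    show ?case by auto
  next
    case (Suc k)
    have "\<exists>g. (\<forall>i<k. Vector_Spaces.linear scale (*) (g i)) \<and>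
      (\<forall>i<k. \<forall>j<k. g i (b j) = (if i = j then 1 else 0)) \<and>
      (\<forall>u. (\<forall>i<k. h i u = 0) \<longrightarrow> (\<forall>i<k. g i u = 0)) \<and>
      (\<forall>u. \<forall>i<k. h i (u - (\<Sum>j<k. scale (g j u) (b j))) = 0)"
      by (rule Suc.IH) (simp_all add: Suc.prems)
    then obtain g where g0: "\<forall>i<k. Vector_Spaces.linear scale (*) (g i)"
      "\<forall>i<k. \<forall>j<k. g i (b j) = (if i = j then 1 else 0)"
      "\<forall>u. (\<forall>i<k. h i u = 0) \<longrightarrow> (\<forall>i<k. g i u = 0)"
      "\<forall>u. \<forall>i<k. h i (u - (\<Sum>j<k. scale (g j u) (b j))) = 0"
      by blast
    have g: "\<And>i. i < k \<Longrightarrow> Vector_Spaces.linear scale (*) (g i)"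
      "\<And>i j. i < k \<Longrightarrow> j < k \<Longrightarrow> g i (b j) = (if i = j then 1 else 0)"
      "\<And>u i. (\<And>i. i < k \<Longrightarrow> h i u = 0) \<Longrightarrow> i < k \<Longrightarrow> g i u = 0"
      "\<And>u i. i < k \<Longrightarrow> h i (u - (\<Sum>j<k. scale (g j u) (b j))) = 0"
      using g0 by blast+
    define R where "R u = u - (\<Sum>j<k. scale (g j u) (b j))" for u
    define g' where "g' i = (if i < k then g i else (\<lambda>u. h k (R u)))" for i
    have gs: "g' i = g i" if "i < k" for i using that by (simp add: g'_def)
    have gk: "g' k u = h k (R u)" for u by (simp add: g'_def)
    have hl: "Vector_Spaces.linear scale (*) (h i)" if "i \<le> k" for i
      using Suc.prems(1)[of i] that by auto
    interpret hk: Vector_Spaces.linear scale "(*)" "h k" by (rule hl) simp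
    have gadd: "g j (x + y) = g j x + g j y" and gscale: "g j (scale r x) = r * g j x"
      if "j < k" for j x y r
      using g(1)[OF that] by (simp_all add: Vector_Spaces.linear_iff)
    have Rlin: "Vector_Spaces.linear scale scale R"
      unfolding Vector_Spaces.linear_iff
    proof (intro conjI allI)
      show "R (x + y) = R x + R y" for x y
        by (simp add: R_def gadd scale_left_distrib sum.distrib)
      show "R (scale r x) = scale r (R x)" for r x
        by (simp add: R_def gscale scale_right_diff_distrib scale_sum_right)
    qed (rule vector_space_axioms)+
    have lin: "Vector_Spaces.linear scale (*) (g' i)" if "i < Suc k" for i
    proof (cases "i < k")
      case False
      then have "g' i = h k \<circ> R" by (auto simp: g'_def)
      then show ?thesis using Vector_Spaces.linear_compose[OF Rlin hl[of k]] by simp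
    qed (use g(1) gs in auto)
    have gbk: "g j (b k) = 0" if "j < k" for j
      using g(3)[of "b k" j] Suc.prems(2) that by auto
    have Rb: "R (b j) = (if j = k then b k else 0)" if "j < Suc k" for j
    proof (cases "j = k")
      case False
      then have "j < k" using that by auto
      then have "(\<Sum>i<k. scale (g i (b j)) (b i)) = (\<Sum>i<k. if i = j then b i else 0)"
        by (intro sum.cong) (auto simp: g(2))
      then show ?thesis using \<open>j < k\<close> False by (simp add: R_def)
    qed (simp add: R_def gbk)
    have 1: "g' i (b j) = (if i = j then 1 else 0)" if "i < Suc k" "j < Suc k" for i j
    proof (cases "i < k")
      case True
      then show ?thesis using that gbk[of i] g(2)[of i j] gs by (auto simp: less_Suc_eq)
    next
      case False
      then show ?thesis using that Suc.prems(3)[of k] by (auto simp: gk Rb hk.zero less_Suc_eq)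
    qed
    have 2: "g' i u = 0" if u: "\<forall>i<Suc k. h i u = 0" and i: "i < Suc k" for u i
    proof -
      have *: "g j u = 0" if "j < k" for j using g(3)[of u j] u that by auto
      then have "R u = u" by (simp add: R_def)
      then show ?thesis using * u i gs gk by (cases "i < k") (auto simp: less_Suc_eq)
    qed
    have R': "u - (\<Sum>j<Suc k. scale (g' j u) (b j)) = R u - scale (h k (R u)) (b k)" for u
      by (simp add: R_def gk gs algebra_simps)
    have 3: "h i (u - (\<Sum>j<Suc k. scale (g' j u) (b j))) = 0" if "i < Suc k" for i u
    proof -
      interpret hi: Vector_Spaces.linear scale "(*)" "h i" by (rule hl) (use that in simp)
      have "h i (u - (\<Sum>j<Suc k. scale (g' j u) (b j))) = h i (R u) - h k (R u) * h i (b k)"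
        unfolding R' by (simp add: hi.diff hi.scale)
      also have "\<dots> = 0"
        using that g(4)[of i u] Suc.prems(2)[of i k] Suc.prems(3)[of k]
        by (cases "i = k") (auto simp: R_def)
      finally show ?thesis .
    qed
    show ?case using lin 1 2 3 by (intro exI[of _ g']) blast
  qed
  then obtain g where "\<forall>i<k. Vector_Spaces.linear scale (*) (g i)"
      "\<forall>i<k. \<forall>j<k. g i (b j) = (if i = j then 1 else 0)"
      "\<forall>u. (\<forall>i<k. h i u = 0) \<longrightarrow> (\<forall>i<k. g i u = 0)"
      "\<forall>u. \<forall>i<k. h i (u - (\<Sum>j<k. scale (g j u) (b j))) = 0"
    by blast
  then show thesis by (intro that[of g]) blast+
qed

end

context endomorphism
begin

section \<open>The cyclic block\<close>

text \<open>The Newton basis \<open>(T - c\<^sub>j\<^sub>-\<^sub>1) \<dots> (T - c\<^sub>0) v\<close>: relative to it \<open>T\<close> has diagonal entries \<open>c\<^sub>j\<close> and links each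
  vector to the next.\<close>

primrec newton :: "(nat \<Rightarrow> 'f) \<Rightarrow> 'v \<Rightarrow> nat \<Rightarrow> 'v" where
  "newton c v 0 = v"
| "newton c v (Suc j) = T (newton c v j) - scale (c j) (newton c v j)"

lemma newton_leading: "newton c v j - (T ^^ j) v \<in> vs1.span (newton c v ` {..<j})"
proof (induction j)
  case 0
  show ?case by (simp add: vs1.span_zero)
next
  case (Suc j)
  let ?w = "newton c v"
  have T: "T x \<in> vs1.span (?w ` {..<Suc j})" if "x \<in> vs1.span (?w ` {..<j})" for x
  proof -
    have "vs1.subspace {x. T x \<in> vs1.span (?w ` {..<Suc j})}"
      by (rule subspace_vimage[unfolded vimage_def]) (rule vs1.subspace_span)
    moreover have "?w ` {..<j} \<subseteq> {x. T x \<in> vs1.span (?w ` {..<Suc j})}"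
    proof safe
      fix i assume "i < j"
      then have "?w (Suc i) + scale (c i) (?w i) \<in> vs1.span (?w ` {..<Suc j})"
        by (intro vs1.span_add vs1.span_scale vs1.span_base imageI) auto
      then show "T (?w i) \<in> vs1.span (?w ` {..<Suc j})" by simp
    qed
    ultimately have "vs1.span (?w ` {..<j}) \<subseteq> {x. T x \<in> vs1.span (?w ` {..<Suc j})}"
      by (intro vs1.span_minimal)
    with that show ?thesis by auto
  qed
  have "T (?w j - (T ^^ j) v) - scale (c j) (?w j) \<in> vs1.span (?w ` {..<Suc j})"
    by (intro vs1.span_diff vs1.span_scale T Suc.IH vs1.span_base imageI) auto
  then show ?case by (simp add: diff algebra_simps)
qed

text \<open>The functionals \<open>f \<circ> T\<^sup>i\<close> see the Newton basis as anti-triangular.  The first value beyond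
  the antidiagonal is what identifies the last diagonal entry of \<open>T\<close> below.\<close>

lemma newton_functional:
  assumes f: "Vector_Spaces.linear scale (*) f"
    and low: "\<And>i. i < m \<Longrightarrow> f ((T ^^ i) v) = 0" and top: "f ((T ^^ m) v) = 1"
  shows "i + j < m \<Longrightarrow> f ((T ^^ i) (newton c v j)) = 0"
    and "i + j = m \<Longrightarrow> f ((T ^^ i) (newton c v j)) = 1"
    and "i + j = Suc m \<Longrightarrow> f ((T ^^ i) (newton c v j)) = f ((T ^^ Suc m) v) - (\<Sum>l<j. c l)"
proof -
  interpret f: Vector_Spaces.linear scale "(*)" f by (fact f)
  have rec: "f ((T ^^ i) (newton c v (Suc j)))
      = f ((T ^^ Suc i) (newton c v j)) - c j * f ((T ^^ i) (newton c v j))" for i j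
  proof -
    interpret Ti: Vector_Spaces.linear scale scale "T ^^ i" by (rule linear_funpow)
    show ?thesis by (simp add: Ti.diff Ti.scale f.diff f.scale funpow_swap1)
  qed
  have A: "i + j < m \<Longrightarrow> f ((T ^^ i) (newton c v j)) = 0" for i j
    by (induction j arbitrary: i) (simp_all add: low rec del: newton.simps(2) funpow.simps)
  have B: "i + j = m \<Longrightarrow> f ((T ^^ i) (newton c v j)) = 1" for i j
    by (induction j arbitrary: i) (simp_all add: top rec A del: newton.simps(2) funpow.simps)
  have C: "i + j = Suc m \<Longrightarrow> f ((T ^^ i) (newton c v j)) = f ((T ^^ Suc m) v) - (\<Sum>l<j. c l)" for i j
    by (induction j arbitrary: i) (simp_all add: rec B del: newton.simps(2) funpow.simps)
  show "i + j < m \<Longrightarrow> f ((T ^^ i) (newton c v j)) = 0"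
    and "i + j = m \<Longrightarrow> f ((T ^^ i) (newton c v j)) = 1"
    and "i + j = Suc m \<Longrightarrow> f ((T ^^ i) (newton c v j)) = f ((T ^^ Suc m) v) - (\<Sum>l<j. c l)"
    using A B C by auto
qed

text \<open>The Newton basis in reverse order, so that the functionals \<open>f \<circ> T\<^sup>i\<close> become triangular and the exceptional
  last vector gets index \<open>0\<close>.  The number \<open>f (T\<^sup>m\<^sup>+\<^sup>1 v)\<close> plays the role of the trace: it makes
  the coefficient of \<open>b 0\<close> in \<open>T (b 0)\<close> equal to \<open>c 0\<close>.\<close>

lemma cyclic_basis:
  assumes f: "Vector_Spaces.linear scale (*) f"
    and low: "\<And>i. i < m \<Longrightarrow> f ((T ^^ i) v) = 0" and top: "f ((T ^^ m) v) = 1"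
    and cyc: "(T ^^ Suc m) v \<in> vs1.span ((\<lambda>i. (T ^^ i) v) ` {..m})"
    and c: "(\<Sum>i\<le>m. c i) = f ((T ^^ Suc m) v)"
  obtains b where
    "\<And>i. i < m \<Longrightarrow> T (b (Suc i)) = scale (c (Suc i)) (b (Suc i)) + b i"
    "T (b 0) - scale (c 0) (b 0) \<in> vs1.span (b ` {1..m})"
    "\<And>i j. i < j \<Longrightarrow> j \<le> m \<Longrightarrow> f ((T ^^ i) (b j)) = 0"
    "\<And>i. i \<le> m \<Longrightarrow> f ((T ^^ i) (b i)) = 1"
    "\<And>V i. vs1.subspace V \<Longrightarrow> v \<in> V \<Longrightarrow> T ` V \<subseteq> V \<Longrightarrow> b i \<in> V"
proof
  interpret f: Vector_Spaces.linear scale "(*)" f by (fact f)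
  define w where "w = newton (\<lambda>j. c (m - j)) v"
  let ?b = "\<lambda>i. w (m - i)"
  note fw = newton_functional[OF f low top, where c = "\<lambda>j. c (m - j)", folded w_def]
  show "T (?b (Suc i)) = scale (c (Suc i)) (?b (Suc i)) + ?b i" if "i < m" for i
  proof -
    have "m - i = Suc (m - Suc i)" "m - (m - Suc i) = Suc i" using that by auto
    then show ?thesis by (simp add: w_def)
  qed
  show "f ((T ^^ i) (?b j)) = 0" if "i < j" "j \<le> m" for i j
    by (rule fw(1)) (use that in auto)
  show "f ((T ^^ i) (?b i)) = 1" if "i \<le> m" for i
    by (rule fw(2)) (use that in auto)
  show "?b i \<in> V" if "vs1.subspace V" "v \<in> V" "T ` V \<subseteq> V" for V i
  proof -
    have "w j \<in> V" for j
      unfolding w_def using that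
      by (induction j) (auto intro!: vs1.subspace_diff vs1.subspace_scale)
    then show ?thesis .
  qed
  have lead: "w j - (T ^^ j) v \<in> vs1.span (w ` {..<j})" for j
    unfolding w_def by (rule newton_leading)
  have pw: "(T ^^ j) v \<in> vs1.span (w ` {..m})" if "j \<le> m" for j
  proof -
    have "w ` {..<j} \<subseteq> w ` {..m}" using that by auto
    then have "w j - (T ^^ j) v \<in> vs1.span (w ` {..m})" using lead[of j] vs1.span_mono by blast
    moreover have "w j \<in> vs1.span (w ` {..m})" using that by (intro vs1.span_base) auto
    ultimately have "w j - (w j - (T ^^ j) v) \<in> vs1.span (w ` {..m})" by (rule vs1.span_diff[rotated])
    then show ?thesis by simp
  qed
  have "vs1.span ((\<lambda>i. (T ^^ i) v) ` {..m}) \<subseteq> vs1.span (w ` {..m})"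
    using pw by (intro vs1.span_minimal vs1.subspace_span) auto
  with cyc have "(T ^^ Suc m) v \<in> vs1.span (w ` {..m})" by auto
  with lead[of "Suc m"] have "(w (Suc m) - (T ^^ Suc m) v) + (T ^^ Suc m) v \<in> vs1.span (w ` {..m})"
    by (intro vs1.span_add) (auto simp: lessThan_Suc_atMost)
  then have "w (Suc m) \<in> vs1.span (insert (w m) (w ` {..<m}))"
    by (simp add: lessThan_Suc flip: lessThan_Suc_atMost)
  then obtain k where k: "w (Suc m) - scale k (w m) \<in> vs1.span (w ` {..<m})"
    by (auto simp: vs1.span_insert)
  have "f (w (Suc m) - scale k (w m)) = 0"
  proof (rule f.eq_0_on_span[OF _ k])
    show "f x = 0" if "x \<in> w ` {..<m}" for x using that fw(1)[of 0] by auto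
  qed
  moreover have "f (w m) = 1" using fw(2)[of 0 m] by simp
  moreover have "f (w (Suc m)) = 0"
  proof -
    have "(\<Sum>l<Suc m. c (m - l)) = (\<Sum>i\<le>m. c i)"
      by (simp only: lessThan_Suc_atMost)
        (rule sum.reindex_bij_witness[of _ "\<lambda>l. m - l" "\<lambda>l. m - l"], auto)
    then show ?thesis using fw(3)[of 0 "Suc m"] c by simp
  qed
  ultimately have "k = 0" by (simp add: f.diff f.scale)
  with k have "w (Suc m) \<in> vs1.span (w ` {..<m})" by simp
  moreover have "w ` {..<m} = ?b ` {1..m}"
  proof safe
    show "w j \<in> ?b ` {1..m}" if "j < m" for j
      by (rule image_eqI[of _ _ "m - j"]) (use that in auto)
    show "?b i \<in> w ` {..<m}" if "i \<in> {1..m}" for i using that by auto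
  qed
  moreover have "w (Suc m) = T (?b 0) - scale (c 0) (?b 0)" by (simp add: w_def)
  ultimately show "T (?b 0) - scale (c 0) (?b 0) \<in> vs1.span (?b ` {1..m})" by simp
qed

text \<open>\<open>E\<close> maps \<open>b i\<close> with odd \<open>i\<close> to \<open>b (i - 1)\<close>, on which it acts as the identity; this
  removes exactly the link from \<open>b i\<close> to \<open>b (i - 1)\<close> in \<open>T\<close>.  So under \<open>T - E\<close> the odd vectors become eigenvectors,
  an even vector is linked to a single odd one with a different eigenvalue, and \<open>b 0\<close> comes last with an eigenvalue of
  its own.\<close>

lemma cyclic_block:
  assumes Tb: "\<And>i. i < m \<Longrightarrow> T (b (Suc i)) = scale (\<mu> (Suc i) + \<epsilon> (Suc i)) (b (Suc i)) + b i"
    and Tb0: "T (b 0) - scale (\<mu> 0 + \<epsilon> 0) (b 0) \<in> vs1.span (b ` {1..m})"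
    and mu: "\<And>i. i \<le> m \<Longrightarrow> \<mu> i \<noteq> 0"
      "\<And>i. 0 < i \<Longrightarrow> i \<le> m \<Longrightarrow> \<mu> i \<noteq> \<mu> 0"
      "\<And>i. 0 < i \<Longrightarrow> i \<le> m \<Longrightarrow> even i \<Longrightarrow> \<mu> (i - 1) \<noteq> \<mu> i"
    and eps: "\<And>i. i \<le> m \<Longrightarrow> odd i \<Longrightarrow> \<epsilon> i = 0"
      "\<And>i. i < m \<Longrightarrow> even i \<Longrightarrow> \<epsilon> i = 1"
      "\<epsilon> m * \<epsilon> m = \<epsilon> m"
    and E: "Vector_Spaces.linear scale scale E"
      "\<And>i. i \<le> m \<Longrightarrow> E (b i) = (if odd i then b (i - 1) else scale (\<epsilon> i) (b i))"
    and N: "\<And>a. a \<noteq> 0 \<Longrightarrow> a ^ N = (1::'f)"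
    and x: "x \<in> vs1.span (b ` {..m})"
  shows "E (E x) = E x" "E x \<in> vs1.span (b ` {..m})" "((\<lambda>y. T y - E y) ^^ N) x = x"
proof -
  interpret E: Vector_Spaces.linear scale scale E by (fact E(1))
  have "Vector_Spaces.linear scale scale (\<lambda>y. T y - E y)"
    unfolding Vector_Spaces.linear_iff
    by (simp add: vs1.vector_space_axioms add scale E.add E.scale vs1.scale_right_diff_distrib)
  then interpret U: endomorphism scale "\<lambda>y. T y - E y" by (rule endomorphism.intro)
  interpret E2: Vector_Spaces.linear scale scale "\<lambda>y. E (E y) - E y"
    unfolding Vector_Spaces.linear_iff
    by (simp add: vs1.vector_space_axioms E.add E.scale vs1.scale_right_diff_distrib)
  have "E (E x) - E x = 0"
  proof (rule E2.eq_0_on_span[OF _ x])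
    fix y assume "y \<in> b ` {..m}"
    then obtain i where i: "i \<le> m" "y = b i" by auto
    show "E (E y) - E y = 0"
    proof (cases "odd i")
      case True
      then have "E (b (i - 1)) = b (i - 1)" using E(2)[of "i - 1"] eps(2)[of "i - 1"] i
        by (cases i) auto
      then show ?thesis using True i E(2) by simp
    next
      case False
      then have "\<epsilon> i * \<epsilon> i = \<epsilon> i" using eps(2)[of i] eps(3) i by (cases "i = m") auto
      then show ?thesis using False i E(2)[of i] by (simp add: E.scale)
    qed
  qed
  then show "E (E x) = E x" by simp
  have "vs1.span (b ` {..m}) \<subseteq> {y. E y \<in> vs1.span (b ` {..m})}"
  proof (rule vs1.span_minimal)
    show "vs1.subspace {y. E y \<in> vs1.span (b ` {..m})}"
      by (rule E.subspace_vimage[unfolded vimage_def]) (rule vs1.subspace_span)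
    show "b ` {..m} \<subseteq> {y. E y \<in> vs1.span (b ` {..m})}"
    proof (intro image_subsetI CollectI)
      fix i assume i: "i \<in> {..m}"
      have "b j \<in> vs1.span (b ` {..m})" if "j \<le> m" for j
        using that by (intro vs1.span_base) auto
      with i show "E (b i) \<in> vs1.span (b ` {..m})" by (auto simp: E(2) intro!: vs1.span_scale)
    qed
  qed
  with x show "E x \<in> vs1.span (b ` {..m})" by auto
  have Ub: "T (b i) - E (b i) = scale (\<mu> i) (b i) + (if odd i then 0 else b (i - 1))"
    if "0 < i" "i \<le> m" for i
    using that Tb[of "i - 1"] E(2)[of i] eps(1)[of i] by (cases i) (auto simp: vs1.scale_left_distrib)
  let ?A = "\<mu> ` {1..m}"
  have mem_odd: "b i \<in> U.eigenspan {\<mu> i}" if "odd i" "i \<le> m" for i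
    unfolding U.eigenspan_def
    by (rule vs1.span_base) (use Ub[of i] that in \<open>cases i; auto\<close>)
  have mem_pos: "b i \<in> U.eigenspan ?A" if i: "0 < i" "i \<le> m" for i
  proof (cases "odd i")
    case True
    then show ?thesis using mem_odd[of i] i U.eigenspan_mono[of "{\<mu> i}" ?A] by auto
  next
    case False
    then have "i - 1 > 0" "odd (i - 1)" using i by (auto elim!: evenE)
    then have "b (i - 1) \<in> U.eigenspan {\<mu> (i - 1)}" using mem_odd i by auto
    then have "b i \<in> U.eigenspan (insert (\<mu> i) {\<mu> (i - 1)})"
      using Ub[of i] i mu(3)[of i] False by (intro U.eigenspan_extend[of _ "\<mu> i"]) auto
    moreover have "i \<in> {1..m}" "i - 1 \<in> {1..m}" using i \<open>i - 1 > 0\<close> by auto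
    then have "insert (\<mu> i) {\<mu> (i - 1)} \<subseteq> ?A" by blast
    ultimately show ?thesis using U.eigenspan_mono by blast
  qed
  have sub: "vs1.span (b ` {1..m}) \<subseteq> U.eigenspan ?A"
    using mem_pos unfolding U.eigenspan_def by (intro vs1.span_minimal vs1.subspace_span) auto
  have eq0: "T (b 0) - E (b 0) - scale (\<mu> 0) (b 0) = T (b 0) - scale (\<mu> 0 + \<epsilon> 0) (b 0)"
    using E(2)[of 0] by (simp add: vs1.scale_left_distrib)
  have "T (b 0) - E (b 0) - scale (\<mu> 0) (b 0) \<in> U.eigenspan ?A"
    unfolding eq0 by (rule subsetD[OF sub Tb0])
  moreover have "\<mu> 0 \<notin> ?A"
  proof
    assume "\<mu> 0 \<in> ?A"
    then obtain i where "\<mu> 0 = \<mu> i" "i \<in> {1..m}" by (rule imageE)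
    then show False using mu(2)[of i] by simp
  qed
  ultimately have mem0: "b 0 \<in> U.eigenspan (insert (\<mu> 0) ?A)" by (rule U.eigenspan_extend)
  have "b ` {..m} \<subseteq> U.eigenspan (insert (\<mu> 0) ?A)"
  proof (rule image_subsetI)
    fix i assume "i \<in> {..m}"
    then show "b i \<in> U.eigenspan (insert (\<mu> 0) ?A)"
      using mem0 mem_pos[of i] U.eigenspan_mono[of ?A "insert (\<mu> 0) ?A"] by (cases "i = 0") auto
  qed
  then have "vs1.span (b ` {..m}) \<subseteq> U.eigenspan (insert (\<mu> 0) ?A)"
    unfolding U.eigenspan_def by (intro vs1.span_minimal vs1.subspace_span)
  with x have "x \<in> U.eigenspan (insert (\<mu> 0) ?A)" by auto
  then show "((\<lambda>y. T y - E y) ^^ N) x = x"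
    by (rule U.eigenspan_funpow_fixed[rotated]) (use mu(1) N in auto)
qed

end

context vector_space
begin

lemma linear_combination_linear:
  assumes "\<And>j. j < k \<Longrightarrow> Vector_Spaces.linear scale (*) (g j)"
  shows "Vector_Spaces.linear scale scale (\<lambda>u. \<Sum>j<k. scale (g j u) (x j))"
proof -
  have gadd: "g j (u + v) = g j u + g j v" and gscale: "g j (scale r u) = r * g j u"
    if "j < k" for j u v r
    using assms[OF that] by (simp_all add: Vector_Spaces.linear_iff)
  show ?thesis
    unfolding Vector_Spaces.linear_iff
    by (simp add: vector_space_axioms gadd gscale scale_left_distrib sum.distrib scale_sum_right)
qed

end

context endomorphism
begin

section \<open>Decomposing an endomorphism of a finite space\<close>

text \<open>Take a vector \<open>v\<close> and a functional \<open>f\<close> with \<open>f (T\<^sup>i v) = 0\<close> for \<open>i < m\<close> and \<open>f (T\<^sup>m v) = 1\<close>, with \<open>m\<close> as large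
  as possible (the \<open>T\<^sup>i v\<close> with \<open>i \<le> m\<close> are distinct, so \<open>m\<close> is bounded).  Maximality applied to \<open>v\<close> with
  other functionals makes the span of the \<open>T\<^sup>i v\<close> invariant; applied to \<open>f\<close> with other vectors it makes the common
  kernel of the \<open>f \<circ> T\<^sup>i\<close> invariant.  These two subspaces are complementary.\<close>

lemma maximal_cyclic_pair:
  assumes V: "vs1.subspace V" "finite V" "T ` V \<subseteq> V" and u: "u \<in> V" "u \<noteq> 0"
  obtains m v f where "v \<in> V" "Vector_Spaces.linear scale (*) f"
    "\<And>i. i < m \<Longrightarrow> f ((T ^^ i) v) = 0" "f ((T ^^ m) v) = 1"
    "(T ^^ Suc m) v \<in> vs1.span ((\<lambda>i. (T ^^ i) v) ` {..m})"
    "\<forall>u\<in>V. (\<forall>i\<le>m. f ((T ^^ i) u) = 0) \<longrightarrow> f ((T ^^ Suc m) u) = 0"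
proof -
  define P where "P n \<longleftrightarrow> (\<exists>v\<in>V. \<exists>f. Vector_Spaces.linear scale (*) f \<and>
    (\<forall>i<n. f ((T ^^ i) v) = 0) \<and> f ((T ^^ n) v) = 1)" for n
  obtain g where "Vector_Spaces.linear scale (*) g" "g u = 1"
    using vs1.separating_functional[OF vs1.subspace_single_0, of u] u by blast
  then have "P 0" using u unfolding P_def by auto
  have TV: "(T ^^ i) x \<in> V" if "x \<in> V" for x i
    by (induction i) (simp_all add: that image_subset_iff[THEN iffD1, OF V(3), rule_format])
  have bound: "n \<le> card V" if "P n" for n
  proof -
    obtain v and f :: "'v \<Rightarrow> 'f" where v: "v \<in> V" "\<forall>i<n. f ((T ^^ i) v) = 0" "f ((T ^^ n) v) = 1"
      using \<open>P n\<close> unfolding P_def by blast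
    have neq: "(T ^^ i) v \<noteq> (T ^^ j) v" if "i < j" "j \<le> n" for i j
    proof
      assume "(T ^^ i) v = (T ^^ j) v"
      then have "(T ^^ (n - j)) ((T ^^ i) v) = (T ^^ (n - j)) ((T ^^ j) v)" by simp
      then have "(T ^^ (n - j + i)) v = (T ^^ (n - j + j)) v" unfolding funpow_add by simp
      moreover have "n - j + i < n" "n - j + j = n" using that by auto
      ultimately show False using v(2,3) by (metis zero_neq_one)
    qed
    have "inj_on (\<lambda>i. (T ^^ i) v) {..n}"
      by (intro linorder_inj_onI) (auto dest: neq)
    moreover have "(\<lambda>i. (T ^^ i) v) ` {..n} \<subseteq> V" using TV v(1) by auto
    ultimately have "card {..n} \<le> card V" using V(2) by (rule card_inj_on_le)
    then show ?thesis by simp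
  qed
  define m where "m = (GREATEST n. P n)"
  have Pm: "P m" unfolding m_def by (rule GreatestI_nat[where P = P, OF \<open>P 0\<close> bound])
  have max: "n \<le> m" if "P n" for n
    unfolding m_def by (rule Greatest_le_nat[where P = P, OF that bound])
  then have notP: "\<not> P (Suc m)" using Suc_n_not_le_n by blast
  obtain v f where v: "v \<in> V" and f: "Vector_Spaces.linear scale (*) f"
    and low: "\<And>i. i < m \<Longrightarrow> f ((T ^^ i) v) = 0" and top: "f ((T ^^ m) v) = 1"
    using Pm unfolding P_def by blast
  show thesis
  proof (rule that[OF v f low top])
    show "(T ^^ Suc m) v \<in> vs1.span ((\<lambda>i. (T ^^ i) v) ` {..m})"
    proof (rule ccontr)
      assume "\<not> ?thesis"
      then obtain g where g: "Vector_Spaces.linear scale (*) g" "g ((T ^^ Suc m) v) = 1"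
        "\<And>z. z \<in> vs1.span ((\<lambda>i. (T ^^ i) v) ` {..m}) \<Longrightarrow> g z = 0"
        using vs1.separating_functional[OF vs1.subspace_span] by metis
      have "g ((T ^^ i) v) = 0" if "i < Suc m" for i
        by (rule g(3), rule vs1.span_base) (use that in auto)
      then have "P (Suc m)" using g(1,2) v unfolding P_def by blast
      with notP show False ..
    qed
    show "\<forall>u\<in>V. (\<forall>i\<le>m. f ((T ^^ i) u) = 0) \<longrightarrow> f ((T ^^ Suc m) u) = 0"
    proof (intro ballI impI, rule ccontr)
      fix u assume u: "u \<in> V" and zero: "\<forall>i\<le>m. f ((T ^^ i) u) = 0"
        and nz: "f ((T ^^ Suc m) u) \<noteq> 0"
      let ?u = "scale (1 / f ((T ^^ Suc m) u)) u"
      have fs: "f ((T ^^ i) ?u) = 1 / f ((T ^^ Suc m) u) * f ((T ^^ i) u)" for i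
        using f linear_funpow[of i] by (simp add: Vector_Spaces.linear_iff)
      have "?u \<in> V" using u V(1) by (intro vs1.subspace_scale)
      moreover have "\<forall>i<Suc m. f ((T ^^ i) ?u) = 0" unfolding fs using zero by auto
      moreover have "f ((T ^^ Suc m) ?u) = 1" unfolding fs using nz by simp
      ultimately have "P (Suc m)" using f unfolding P_def by blast
      with notP show False ..
    qed
  qed
qed

text \<open>Induction over invariant subspaces \<open>V\<close> of one fixed space, rather than over dimensions: the block \<open>Z\<close> is treated
  by \<open>cyclic_block\<close>, its complement \<open>W\<close> by the induction hypothesis, and the two idempotents are glued along the
  projection \<open>P\<close> onto \<open>Z\<close>.\<close>

theorem torsion_clean_on_finite_subspace:
  assumes card: "card (UNIV :: 'f set) \<ge> 5" and two: "(2::'f) \<noteq> 0"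
    and N: "\<And>a::'f. a \<noteq> 0 \<Longrightarrow> a ^ N = 1"
    and "finite V" "vs1.subspace V" "T ` V \<subseteq> V"
  shows "\<exists>E. Vector_Spaces.linear scale scale E \<and> E ` V \<subseteq> V \<and>
    (\<forall>x\<in>V. E (E x) = E x \<and> ((\<lambda>y. T y - E y) ^^ N) x = x)"
  using assms(4-6)
proof (induction V rule: finite_psubset_induct)
  case (psubset V)
  show ?case
  proof (cases "V = {0}")
    case True
    interpret TN: Vector_Spaces.linear scale scale "T ^^ N" by (rule linear_funpow)
    have "Vector_Spaces.linear scale scale (\<lambda>_. 0)"
      by (simp add: Vector_Spaces.linear_iff vs1.vector_space_axioms)
    then show ?thesis using True by (intro exI[of _ "\<lambda>_. 0"]) (auto simp: TN.zero)
  next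
    case False
    then obtain u where u: "u \<in> V" "u \<noteq> 0" using vs1.subspace_0[OF psubset.prems(1)] by auto
    obtain m v f where v: "v \<in> V" and f: "Vector_Spaces.linear scale (*) f"
      and low: "\<And>i. i < m \<Longrightarrow> f ((T ^^ i) v) = 0" and top: "f ((T ^^ m) v) = 1"
      and cyc: "(T ^^ Suc m) v \<in> vs1.span ((\<lambda>i. (T ^^ i) v) ` {..m})"
      and ann: "\<forall>u\<in>V. (\<forall>i\<le>m. f ((T ^^ i) u) = 0) \<longrightarrow> f ((T ^^ Suc m) u) = 0"
      by (rule maximal_cyclic_pair[OF psubset.prems(1) psubset.hyps psubset.prems(2) u]) (rule that)
    obtain \<mu> \<epsilon> where mu: "\<And>i. i \<le> m \<Longrightarrow> \<mu> i \<noteq> 0"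
        "\<And>i. 0 < i \<Longrightarrow> i \<le> m \<Longrightarrow> \<mu> i \<noteq> \<mu> 0"
        "\<And>i. 0 < i \<Longrightarrow> i \<le> m \<Longrightarrow> even i \<Longrightarrow> \<mu> (i - 1) \<noteq> \<mu> i"
      and eps: "\<And>i. i \<le> m \<Longrightarrow> odd i \<Longrightarrow> \<epsilon> i = 0"
        "\<And>i. i < m \<Longrightarrow> even i \<Longrightarrow> \<epsilon> i = 1" "\<epsilon> m * \<epsilon> m = \<epsilon> m"
      and trace: "(\<Sum>i\<le>m. \<mu> i + \<epsilon> i) = f ((T ^^ Suc m) v)"
      by (rule choose_spectrum[OF card two, of m "f ((T ^^ Suc m) v)"]) (rule that)
    obtain b where
      Tb: "\<And>i. i < m \<Longrightarrow> T (b (Suc i)) = scale (\<mu> (Suc i) + \<epsilon> (Suc i)) (b (Suc i)) + b i"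
      and Tb0: "T (b 0) - scale (\<mu> 0 + \<epsilon> 0) (b 0) \<in> vs1.span (b ` {1..m})"
      and tri: "\<And>i j. i < j \<Longrightarrow> j \<le> m \<Longrightarrow> f ((T ^^ i) (b j)) = 0"
      and diag: "\<And>i. i \<le> m \<Longrightarrow> f ((T ^^ i) (b i)) = 1"
      and bV: "\<And>V i. vs1.subspace V \<Longrightarrow> v \<in> V \<Longrightarrow> T ` V \<subseteq> V \<Longrightarrow> b i \<in> V"
      by (rule cyclic_basis[OF f low top cyc trace], assumption, rule that)
    have b_in: "b i \<in> V" for i using bV psubset.prems v by blast
    have hlin: "Vector_Spaces.linear scale (*) (\<lambda>u. f ((T ^^ i) u))" for i
      using Vector_Spaces.linear_compose[OF linear_funpow f, of i] by (simp add: o_def)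
    obtain g where glin: "\<And>i. i < Suc m \<Longrightarrow> Vector_Spaces.linear scale (*) (g i)"
      and gb: "\<And>i j. i < Suc m \<Longrightarrow> j < Suc m \<Longrightarrow> g i (b j) = (if i = j then 1 else 0)"
      and g0: "\<And>u i. (\<And>i. i < Suc m \<Longrightarrow> f ((T ^^ i) u) = 0) \<Longrightarrow> i < Suc m \<Longrightarrow> g i u = 0"
      and gproj: "\<And>u i. i < Suc m \<Longrightarrow> f ((T ^^ i) (u - (\<Sum>j<Suc m. scale (g j u) (b j)))) = 0"
      by (rule vs1.dual_family[of "Suc m" "\<lambda>i u. f ((T ^^ i) u)" b])
        (use hlin tri diag in auto)
    define P where "P u = (\<Sum>j<Suc m. scale (g j u) (b j))" for u
    define W where "W = {u \<in> V. \<forall>i\<le>m. f ((T ^^ i) u) = 0}"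
    have hadd: "f ((T ^^ i) (x + y)) = f ((T ^^ i) x) + f ((T ^^ i) y)"
      and hscale: "f ((T ^^ i) (scale r x)) = r * f ((T ^^ i) x)" for i x y r
      using hlin[of i] by (simp_all add: Vector_Spaces.linear_iff)
    have W: "vs1.subspace W"
      unfolding W_def using psubset.prems(1) hscale[of _ 0]
      by (auto simp: vs1.subspace_def hadd hscale)
    have TW: "T ` W \<subseteq> W"
    proof
      fix y assume "y \<in> T ` W"
      then obtain u where u: "u \<in> W" "y = T u" by auto
      have "f ((T ^^ i) (T u)) = 0" if "i \<le> m" for i
      proof -
        have "f ((T ^^ Suc i) u) = 0"
        proof (cases "i = m")
          case True
          then show ?thesis using u(1) ann unfolding W_def by blast
        next
          case False
          then have "Suc i \<le> m" using that by simp
          then show ?thesis using u(1) unfolding W_def by blast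
        qed
        then show ?thesis by (simp add: funpow_swap1)
      qed
      then show "y \<in> W" using u psubset.prems(2) by (auto simp: W_def)
    qed
    have "v \<notin> W" using top by (auto simp: W_def)
    then have "W \<subset> V" using v by (auto simp: W_def)
    then obtain E' where E': "Vector_Spaces.linear scale scale E'" "E' ` W \<subseteq> W"
      "\<forall>x\<in>W. E' (E' x) = E' x \<and> ((\<lambda>y. T y - E' y) ^^ N) x = x"
      using psubset.IH[of W] W TW by blast
    interpret E': Vector_Spaces.linear scale scale E' by (fact E'(1))
    define e where "e i = (if odd i then b (i - 1) else scale (\<epsilon> i) (b i))" for i
    define E where "E u = (\<Sum>j<Suc m. scale (g j u) (e j)) + E' (u - P u)" for u
    have Plin: "Vector_Spaces.linear scale scale P"
      unfolding P_def by (rule vs1.linear_combination_linear) (rule glin)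
    have Qlin: "Vector_Spaces.linear scale scale (\<lambda>u. \<Sum>j<Suc m. scale (g j u) (e j))"
      by (rule vs1.linear_combination_linear) (rule glin)
    have Elin: "Vector_Spaces.linear scale scale E"
      using Plin Qlin E'(1) unfolding E_def Vector_Spaces.linear_iff
      by (simp add: vs1.scale_right_distrib vs1.scale_right_diff_distrib E'.diff del: sum.lessThan_Suc)
    interpret E: Vector_Spaces.linear scale scale E by (fact Elin)
    have Eb: "E (b i) = e i" if "i \<le> m" for i
    proof -
      have sum: "(\<Sum>j<Suc m. scale (g j (b i)) (x j)) = x i" for x
      proof -
        have "(\<Sum>j<Suc m. scale (g j (b i)) (x j)) = (\<Sum>j<Suc m. if j = i then x i else 0)"
          by (rule sum.cong) (use gb that in auto)
        then show ?thesis using that by simp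
      qed
      show ?thesis unfolding E_def P_def sum by (simp add: E'.zero)
    qed
    have EW: "E u = E' u" if "u \<in> W" for u
    proof -
      have "g j u = 0" if "j < Suc m" for j
        using g0[of u j] that \<open>u \<in> W\<close> by (auto simp: W_def)
      then show ?thesis by (simp add: E_def P_def)
    qed
    have Ulin: "Vector_Spaces.linear scale scale (\<lambda>y. T y - E y)"
      unfolding Vector_Spaces.linear_iff
      by (simp add: vs1.vector_space_axioms add scale E.add E.scale vs1.scale_right_diff_distrib)
    then interpret U: endomorphism scale "\<lambda>y. T y - E y" by (rule endomorphism.intro)
    interpret UN: Vector_Spaces.linear scale scale "(\<lambda>y. T y - E y) ^^ N" by (rule U.linear_funpow)
    let ?Z = "vs1.span (b ` {..m})"
    have ZV: "?Z \<subseteq> V" using b_in psubset.prems(1) by (intro vs1.span_minimal) auto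
    have PZ: "P u \<in> ?Z" for u
      unfolding P_def by (intro vs1.span_sum vs1.span_scale vs1.span_base) auto
    have RW: "u - P u \<in> W" if "u \<in> V" for u
      using that gproj PZ[of u] ZV vs1.subspace_diff[OF psubset.prems(1)]
      by (auto simp: W_def P_def less_Suc_eq_le)
    have block: "E (E x) = E x" "E x \<in> ?Z" "((\<lambda>y. T y - E y) ^^ N) x = x" if "x \<in> ?Z" for x
      using cyclic_block[OF Tb Tb0 mu eps Elin _ N that] Eb by (auto simp: e_def)
    have UW: "((\<lambda>y. T y - E y) ^^ n) u = ((\<lambda>y. T y - E' y) ^^ n) u \<and>
        ((\<lambda>y. T y - E' y) ^^ n) u \<in> W" if "u \<in> W" for u n
    proof (induction n)
      case (Suc n)
      have "T y - E' y \<in> W" if "y \<in> W" for y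
        using that TW E'(2) by (intro vs1.subspace_diff[OF W]) blast+
      with Suc show ?case by (simp add: EW)
    qed (use that in simp)
    have "E x \<in> V \<and> E (E x) = E x \<and> ((\<lambda>y. T y - E y) ^^ N) x = x" if "x \<in> V" for x
    proof -
      have split: "x = P x + (x - P x)" by simp
      note R = RW[OF that]
      have "E x = E (P x) + E' (x - P x)" using E.add[of "P x" "x - P x"] EW[OF R] by simp
      moreover have "E' (x - P x) \<in> W" using R E'(2) by blast
      moreover have "E (E' (x - P x)) = E' (x - P x)"
        using EW[OF \<open>E' (x - P x) \<in> W\<close>] E'(3) R by auto
      ultimately have "E x \<in> V" "E (E x) = E x"
        using block(1,2)[OF PZ[of x]] ZV \<open>W \<subset> V\<close> psubset.prems(1)
        by (auto simp: E.add intro!: vs1.subspace_add)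
      moreover have "((\<lambda>y. T y - E y) ^^ N) x
          = ((\<lambda>y. T y - E y) ^^ N) (P x) + ((\<lambda>y. T y - E y) ^^ N) (x - P x)"
        using UN.add[of "P x" "x - P x"] by simp
      moreover have "((\<lambda>y. T y - E y) ^^ N) (x - P x) = x - P x"
        using UW[OF R] E'(3) R by auto
      ultimately show ?thesis using block(3)[OF PZ[of x]] by simp
    qed
    then show ?thesis using Elin by (intro exI[of _ E]) auto
  qed
qed

end

section \<open>Scalar matrices\<close>

lemma mult_mat_vec_smult:
  fixes A :: "'a::comm_ring_1 mat"
  assumes "A \<in> carrier_mat nr nc" "v \<in> carrier_vec nc"
  shows "A *\<^sub>v (c \<cdot>\<^sub>v v) = c \<cdot>\<^sub>v (A *\<^sub>v v)" "(c \<cdot>\<^sub>m A) *\<^sub>v v = c \<cdot>\<^sub>v (A *\<^sub>v v)"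
  using assms by (auto intro!: eq_vecI simp: scalar_prod_def sum_distrib_left ac_simps)

lemma pow_mat_mult_vec_eigen:
  fixes U :: "'a::comm_ring_1 mat"
  assumes U: "U \<in> carrier_mat n n" and v: "v \<in> carrier_vec n" and eig: "U *\<^sub>v v = c \<cdot>\<^sub>v v"
  shows "(U ^\<^sub>m k) *\<^sub>v v = (c ^ k) \<cdot>\<^sub>v v"
proof (induction k)
  case 0
  show ?case using U v by simp
next
  case (Suc k)
  have "(U ^\<^sub>m Suc k) *\<^sub>v v = (U ^\<^sub>m k) *\<^sub>v (U *\<^sub>v v)"
    using U v by (simp add: assoc_mult_mat_vec[where n\<^sub>1 = n and n\<^sub>2 = n and n\<^sub>3 = n])
  also have "\<dots> = c \<cdot>\<^sub>v ((U ^\<^sub>m k) *\<^sub>v v)"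
    unfolding eig using U v by (intro mult_mat_vec_smult(1)[OF pow_carrier_mat[OF U] v])
  also have "\<dots> = (c ^ Suc k) \<cdot>\<^sub>v v" unfolding Suc by (simp add: smult_smult_assoc)
  finally show ?case .
qed

text \<open>If \<open>e\<close> is a nonzero idempotent, a nonzero column \<open>v\<close> of \<open>e\<close> satisfies \<open>e v = v\<close>, so \<open>u\<close> acts on it as
  \<open>a - 1\<close> or \<open>a + 1\<close>; then \<open>u\<^sup>k = 1\<close> makes that scalar a root of unity.\<close>

lemma weakly_torsion_clean_scalar:
  fixes a :: "'a::idom"
  assumes weak: "weakly_torsion_clean_prop (ring_mat TYPE('a) n ()) k" and n: "n > 0"
  shows "a ^ k = 1 \<or> (a - 1) ^ k = 1 \<or> (a + 1) ^ k = 1"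
proof -
  let ?R = "ring_mat TYPE('a) n ()"
  interpret R: ring ?R by (rule ring_mat)
  let ?r = "a \<cdot>\<^sub>m 1\<^sub>m n"
  have r: "?r \<in> carrier ?R" by (simp add: ring_mat_simps)
  obtain u e where u: "u \<in> Units ?R" and e: "e \<in> carrier ?R"
    and uk: "u [^]\<^bsub>?R\<^esub> k = \<one>\<^bsub>?R\<^esub>" and ee: "e \<otimes>\<^bsub>?R\<^esub> e = e"
    and dec: "?r = u \<oplus>\<^bsub>?R\<^esub> e \<or> ?r = u \<ominus>\<^bsub>?R\<^esub> e"
    using weak r unfolding weakly_torsion_clean_prop_def by blast
  have uc: "u \<in> carrier_mat n n" and ec: "e \<in> carrier_mat n n"
    using R.Units_closed[OF u] e by (simp_all add: ring_mat_simps)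
  have uk: "u ^\<^sub>m k = 1\<^sub>m n"
    using uk pow_mat_ring_pow[OF uc, of k "()"] by (simp add: ring_mat_simps)
  have ee: "e * e = e" using ee by (simp add: ring_mat_simps)
  obtain s :: 'a where s: "s = 1 \<or> s = - 1" and us: "u = ?r + s \<cdot>\<^sub>m e"
  proof -
    from dec show thesis
    proof
      assume "?r = u \<oplus>\<^bsub>?R\<^esub> e"
      then have "?r = u + e" by (simp add: ring_mat_simps)
      then have "u = ?r + (- 1) \<cdot>\<^sub>m e" using uc ec by (intro eq_matI) auto
      then show thesis using that by blast
    next
      assume "?r = u \<ominus>\<^bsub>?R\<^esub> e"
      moreover have "(u \<ominus>\<^bsub>?R\<^esub> e) \<oplus>\<^bsub>?R\<^esub> e = u"
        using R.Units_closed[OF u] e by (simp add: R.minus_eq R.a_assoc R.l_neg)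
      ultimately have "u = ?r + e" by (simp add: ring_mat_simps)
      then have "u = ?r + 1 \<cdot>\<^sub>m e" using uc ec by (intro eq_matI) auto
      then show thesis using that by blast
    qed
  qed
  have uv: "u *\<^sub>v v = a \<cdot>\<^sub>v v + s \<cdot>\<^sub>v (e *\<^sub>v v)" if v: "v \<in> carrier_vec n" for v
  proof -
    have "u *\<^sub>v v = ?r *\<^sub>v v + (s \<cdot>\<^sub>m e) *\<^sub>v v"
      unfolding us using ec v by (intro add_mult_distrib_mat_vec) auto
    also have "?r *\<^sub>v v = a \<cdot>\<^sub>v v" using v by (subst mult_mat_vec_smult(2)[of _ n n]) auto
    also have "(s \<cdot>\<^sub>m e) *\<^sub>v v = s \<cdot>\<^sub>v (e *\<^sub>v v)" by (rule mult_mat_vec_smult(2)[OF ec v])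
    finally show ?thesis .
  qed
  have root: "c ^ k = 1" if v: "v \<in> carrier_vec n" "v $ i \<noteq> 0" "i < n" and "u *\<^sub>v v = c \<cdot>\<^sub>v v" for v c i
  proof -
    have "v = (c ^ k) \<cdot>\<^sub>v v"
      using pow_mat_mult_vec_eigen[OF uc v(1) that(4), of k] v(1) by (simp add: uk)
    then have "v $ i = c ^ k * v $ i" using v by (metis carrier_vecD index_smult_vec(1))
    with v(2) show ?thesis by simp
  qed
  show ?thesis
  proof (cases "e = 0\<^sub>m n n")
    case True
    let ?v = "unit_vec n 0 :: 'a vec"
    have "u *\<^sub>v ?v = a \<cdot>\<^sub>v ?v + s \<cdot>\<^sub>v (e *\<^sub>v ?v)" by (rule uv) simp
    also have "\<dots> = a \<cdot>\<^sub>v ?v" unfolding True by (intro eq_vecI) auto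
    finally have "u *\<^sub>v ?v = a \<cdot>\<^sub>v ?v" .
    then have "a ^ k = 1" using n by (intro root[of ?v 0]) auto
    then show ?thesis by simp
  next
    case False
    have "\<exists>i j. i < n \<and> j < n \<and> e $$ (i, j) \<noteq> 0"
    proof (rule ccontr)
      assume "\<not> ?thesis"
      then have "e = 0\<^sub>m n n" using ec by (intro eq_matI) auto
      with False show False ..
    qed
    then obtain i j where ij: "i < n" "j < n" "e $$ (i, j) \<noteq> 0" by blast
    let ?v = "col e j"
    have v: "?v \<in> carrier_vec n" using ec by auto
    have "e *\<^sub>v ?v = col (e * e) j" using ec ij by (intro col_mult2[symmetric]) auto
    then have "u *\<^sub>v ?v = a \<cdot>\<^sub>v ?v + s \<cdot>\<^sub>v ?v" using uv[OF v] ee by simp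
    also have "\<dots> = (a + s) \<cdot>\<^sub>v ?v" by (simp add: add_smult_distrib_vec)
    finally have "(a + s) ^ k = 1"
      using ij ec by (intro root[OF v, of i]) auto
    then show ?thesis using s by auto
  qed
qed

section \<open>Finite integral domains\<close>

text \<open>The reason for passing to the fraction field is one of types: vector spaces need scalars in the class of fields,
  and finiteness of an integral domain is only a hypothesis here.\<close>

lemma finite_idom_to_fract_surj:
  assumes "finite (UNIV :: 'a::idom set)"
  shows "surj (to_fract :: 'a \<Rightarrow> 'a fract)"
proof -
  have "x \<in> range to_fract" for x :: "'a fract"
  proof (cases x)
    case (Fract a b)
    have "inj ((*) b)" using Fract(2) by (auto simp: inj_on_def)
    then have "surj ((*) b)" using assms by (rule finite_UNIV_inj_surj[rotated])
    then obtain c where c: "b * c = 1" by (metis surjD)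
    have "x = to_fract (a * c)"
      using c Fract by (simp add: to_fract_def eq_fract ac_simps)
    then show ?thesis by blast
  qed
  then show ?thesis by blast
qed

lemma card_fract_of_finite:
  assumes "finite (UNIV :: 'a::idom set)"
  shows "finite (UNIV :: 'a fract set)" "card (UNIV :: 'a fract set) = card (UNIV :: 'a set)"
proof -
  have "bij (to_fract :: 'a \<Rightarrow> 'a fract)"
    using finite_idom_to_fract_surj[OF assms] by (simp add: bij_def inj_def)
  then show "finite (UNIV :: 'a fract set)" "card (UNIV :: 'a fract set) = card (UNIV :: 'a set)"
    using bij_betw_finite bij_betw_same_card assms by metis+
qed

lemma two_fract_neq_zero: "(2::'a::idom fract) \<noteq> 0" if "(2::'a) \<noteq> 0"
proof -
  have "to_fract (2::'a) = 2" using to_fract_add[of "1::'a" 1] by simp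
  then show ?thesis using that to_fract_eq_0_iff[of "2::'a"] by metis
qed

lemma finite_idom_field:
  assumes "finite (UNIV :: 'a::idom set)"
  shows "field (class_ring :: 'a ring)"
proof -
  have "\<exists>y. x * y = 1" if "x \<noteq> 0" for x :: 'a
  proof -
    have "inj ((*) x)" using that by (auto simp: inj_on_def)
    then have "surj ((*) x)" using assms by (rule finite_UNIV_inj_surj[rotated])
    then show ?thesis by (metis surjD)
  qed
  then show ?thesis
    by (intro class_cring.cring_fieldI) (force simp: Units_def mult.commute)
qed

section \<open>Matrices as endomorphisms of a coordinate space\<close>

text \<open>Vectors of length \<open>n\<close> are functions on the naturals that vanish from \<open>n\<close> on, so that vectors of all
  lengths live in one vector space type.\<close>

definition pscale :: "'f::field \<Rightarrow> (nat \<Rightarrow> 'f) \<Rightarrow> nat \<Rightarrow> 'f" where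
  "pscale c x = (\<lambda>i. c * x i)"

lemma vector_space_pscale: "vector_space (pscale :: 'f::field \<Rightarrow> _)"
  by unfold_locales (auto simp: pscale_def algebra_simps fun_eq_iff)

definition coord_space :: "nat \<Rightarrow> (nat \<Rightarrow> 'f::field) set" where
  "coord_space n = {x. \<forall>i\<ge>n. x i = 0}"

definition unit_fun :: "nat \<Rightarrow> nat \<Rightarrow> 'f::field" where
  "unit_fun j = (\<lambda>i. if i = j then 1 else 0)"

definition coord_mat :: "nat \<Rightarrow> ((nat \<Rightarrow> 'f::field) \<Rightarrow> nat \<Rightarrow> 'f) \<Rightarrow> 'f mat" where
  "coord_mat n L = mat n n (\<lambda>(i, j). L (unit_fun j) i)"

lemma coord_mat_carrier [simp]: "coord_mat n L \<in> carrier_mat n n"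
  by (simp add: coord_mat_def)

lemma unit_fun_in: "j < n \<Longrightarrow> unit_fun j \<in> coord_space n"
  by (auto simp: unit_fun_def coord_space_def)

lemma subspace_coord_space: "module.subspace pscale (coord_space n)"
  by (auto simp: module.subspace_def[OF vector_space_pscale[folded module_iff_vector_space]]
      coord_space_def pscale_def)

lemma finite_coord_space:
  assumes "finite (UNIV :: 'f::field set)"
  shows "finite (coord_space n :: (nat \<Rightarrow> 'f) set)"
proof -
  have "coord_space n = {f. \<forall>x. (x \<in> {..<n} \<longrightarrow> f x \<in> (UNIV :: 'f set)) \<and> (x \<notin> {..<n} \<longrightarrow> f x = 0)}"
    by (auto simp: coord_space_def not_less)
  then show ?thesis using finite_set_of_finite_funs[of "{..<n}" "UNIV :: 'f set" 0] assms by simp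
qed

lemma linear_apply_coord:
  assumes L: "Vector_Spaces.linear pscale pscale L" and x: "x \<in> coord_space n"
  shows "L x i = (\<Sum>j<n. x j * L (unit_fun j) i)"
proof -
  interpret L: Vector_Spaces.linear pscale pscale L by (fact L)
  have sum_apply: "(\<Sum>j\<in>A. F j) i = (\<Sum>j\<in>A. F j i)" if "finite A"
    for A :: "nat set" and F :: "nat \<Rightarrow> nat \<Rightarrow> 'a" and i
    using that by (induction A rule: finite_induct) auto
  have "x = (\<Sum>j<n. pscale (x j) (unit_fun j))"
  proof
    fix i
    have "(\<Sum>j<n. pscale (x j) (unit_fun j) i) = (\<Sum>j<n. if j = i then x i else 0)"
      by (rule sum.cong) (auto simp: pscale_def unit_fun_def)
    also have "\<dots> = x i" using x by (auto simp: coord_space_def)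
    finally show "x i = (\<Sum>j<n. pscale (x j) (unit_fun j)) i" by (simp add: sum_apply)
  qed
  then have "L x = L (\<Sum>j<n. pscale (x j) (unit_fun j))" by simp
  also have "\<dots> = (\<Sum>j<n. pscale (x j) (L (unit_fun j)))" by (simp add: L.sum L.scale)
  finally show ?thesis by (simp add: sum_apply pscale_def)
qed

lemma coord_mat_comp:
  assumes L: "Vector_Spaces.linear pscale pscale L" and M: "M ` coord_space n \<subseteq> coord_space n"
  shows "coord_mat n (\<lambda>x. L (M x)) = coord_mat n L * coord_mat n M"
proof (rule eq_matI)
  fix i j assume ij: "i < dim_row (coord_mat n L * coord_mat n M)" "j < dim_col (coord_mat n L * coord_mat n M)"
  then have "i < n" "j < n" by (simp_all add: coord_mat_def)
  moreover have "M (unit_fun j) \<in> coord_space n" using M unit_fun_in[OF \<open>j < n\<close>] by blast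
  ultimately show "coord_mat n (\<lambda>x. L (M x)) $$ (i, j) = (coord_mat n L * coord_mat n M) $$ (i, j)"
    by (simp add: coord_mat_def scalar_prod_def linear_apply_coord[OF L] lessThan_atLeast0 mult.commute)
qed (simp_all add: coord_mat_def)

lemma coord_mat_funpow:
  assumes L: "Vector_Spaces.linear pscale pscale L" and V: "L ` coord_space n \<subseteq> coord_space n"
  shows "coord_mat n (L ^^ k) = coord_mat n L ^\<^sub>m k"
proof (induction k)
  case 0
  show ?case by (rule eq_matI) (auto simp: coord_mat_def unit_fun_def)
next
  case (Suc k)
  interpret endomorphism pscale L by (intro endomorphism.intro L)
  have "L ^^ Suc k = (\<lambda>x. (L ^^ k) (L x))" by (simp add: funpow_swap1 fun_eq_iff)
  then have "coord_mat n (L ^^ Suc k) = coord_mat n (L ^^ k) * coord_mat n L"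
    by (simp only: coord_mat_comp[OF linear_funpow V])
  then show ?case by (simp add: Suc del: funpow.simps)
qed

lemma root_of_identity_in_Units:
  fixes R (structure) and k :: nat
  assumes "ring R" "u \<in> carrier R" "k > 0" "u [^]\<^bsub>R\<^esub> k = \<one>\<^bsub>R\<^esub>"
  shows "u \<in> Units R"
proof -
  interpret ring R by fact
  obtain l where "k = Suc l" using assms(3) gr0_implies_Suc by blast
  then have "u [^]\<^bsub>R\<^esub> l \<otimes>\<^bsub>R\<^esub> u = \<one>\<^bsub>R\<^esub>" "u \<otimes>\<^bsub>R\<^esub> u [^]\<^bsub>R\<^esub> l = \<one>\<^bsub>R\<^esub>"
    using assms nat_pow_Suc2[of u l] by auto
  then show ?thesis using assms(2) by (auto simp: Units_def intro!: bexI[of _ "u [^]\<^bsub>R\<^esub> l"])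
qed

section \<open>The exponent of a matrix ring\<close>

lemma torsion_clean_prop_mat:
  assumes fin: "finite (UNIV :: 'a::idom set)" and card: "card (UNIV :: 'a set) \<ge> 5"
    and two: "(2::'a) \<noteq> 0"
  shows "torsion_clean_prop (ring_mat TYPE('a) n ()) (card (UNIV :: 'a set) - 1)"
proof -
  let ?R = "ring_mat TYPE('a) n ()" and ?N = "card (UNIV :: 'a set) - 1"
  let ?h = "to_fract :: 'a \<Rightarrow> 'a fract" and ?V = "coord_space n :: (nat \<Rightarrow> 'a fract) set"
  interpret h: inj_comm_ring_hom ?h by unfold_locales auto
  note surj = finite_idom_to_fract_surj[OF fin]
  note finF = card_fract_of_finite(1)[OF fin] and cardF = card_fract_of_finite(2)[OF fin]
  note twoF = two_fract_neq_zero[OF two]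
  have powF: "a ^ ?N = 1" if "a \<noteq> 0" for a :: "'a fract"
    using finite_field_power[OF finF that] cardF by simp
  show ?thesis
    unfolding torsion_clean_prop_def
  proof
    fix A assume "A \<in> carrier ?R"
    then have A: "A \<in> carrier_mat n n" by (simp add: ring_mat_simps)
    define T where "T x = (\<lambda>i. if i < n then \<Sum>j<n. ?h (A $$ (i, j)) * x j else 0)" for x
    have Tlin: "Vector_Spaces.linear pscale pscale T"
      unfolding Vector_Spaces.linear_iff
      by (simp add: vector_space_pscale T_def pscale_def fun_eq_iff algebra_simps sum.distrib sum_distrib_left)
    interpret T: endomorphism pscale T by (intro endomorphism.intro Tlin)
    have TV: "T ` ?V \<subseteq> ?V" by (auto simp: T_def coord_space_def)
    have "card (UNIV :: 'a fract set) \<ge> 5" using card cardF by simp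
    from T.torsion_clean_on_finite_subspace[OF this twoF powF finite_coord_space[OF finF] subspace_coord_space TV]
    obtain E where Elin: "Vector_Spaces.linear pscale pscale E" and EV: "E ` ?V \<subseteq> ?V"
      and E': "\<forall>x\<in>?V. E (E x) = E x \<and> ((\<lambda>y. T y - E y) ^^ ?N) x = x"
      by blast
    have E: "E (E x) = E x" "((\<lambda>y. T y - E y) ^^ ?N) x = x" if "x \<in> ?V" for x
      using E' that by blast+
    define U where "U y = T y - E y" for y
    interpret E: Vector_Spaces.linear pscale pscale E by (fact Elin)
    have Ulin: "Vector_Spaces.linear pscale pscale U"
      unfolding U_def Vector_Spaces.linear_iff
      by (simp add: vector_space_pscale T.add T.scale E.add E.scale T.vs1.scale_right_diff_distrib)
    have UV: "U ` ?V \<subseteq> ?V"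
    proof (rule image_subsetI)
      fix y assume "y \<in> ?V"
      then have "T y \<in> ?V" "E y \<in> ?V" using TV EV by blast+
      then show "U y \<in> ?V" by (simp add: U_def coord_space_def)
    qed
    have matT: "coord_mat n T = map_mat ?h A"
    proof (rule eq_matI)
      fix i j assume "i < dim_row (map_mat ?h A)" "j < dim_col (map_mat ?h A)"
      then have ij: "i < n" "j < n" using A by auto
      have "(\<Sum>l<n. ?h (A $$ (i, l)) * unit_fun j l) = (\<Sum>l<n. if l = j then ?h (A $$ (i, j)) else 0)"
        by (rule sum.cong) (auto simp: unit_fun_def)
      then show "coord_mat n T $$ (i, j) = map_mat ?h A $$ (i, j)"
        using ij A by (simp add: coord_mat_def T_def)
    qed (use A in \<open>simp_all add: coord_mat_def\<close>)
    define e where "e = map_mat (inv_into UNIV ?h) (coord_mat n E)"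
    define u where "u = A - e"
    have e: "e \<in> carrier_mat n n" by (simp add: e_def)
    have u: "u \<in> carrier_mat n n" unfolding u_def using e by (rule minus_carrier_mat)
    have he: "map_mat ?h e = coord_mat n E"
      by (rule eq_matI) (auto simp: e_def surj_f_inv_f[OF surj])
    have hu: "map_mat ?h u = coord_mat n U"
    proof (rule eq_matI)
      fix i j assume "i < dim_row (coord_mat n U)" "j < dim_col (coord_mat n U)"
      then have ij: "i < n" "j < n" by (simp_all add: coord_mat_def)
      have "map_mat ?h u $$ (i, j) = map_mat ?h A $$ (i, j) - map_mat ?h e $$ (i, j)"
        using ij A e by (simp add: u_def)
      also have "\<dots> = coord_mat n U $$ (i, j)"
        unfolding he matT[symmetric] using ij by (simp add: coord_mat_def U_def)
      finally show "map_mat ?h u $$ (i, j) = coord_mat n U $$ (i, j)" .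
    qed (use u in \<open>simp_all add: coord_mat_def\<close>)
    have "map_mat ?h (e * e) = coord_mat n (\<lambda>x. E (E x))"
      by (simp add: h.mat_hom_mult[OF e e] he coord_mat_comp[OF Elin EV])
    also have "\<dots> = map_mat ?h e"
      unfolding he by (rule eq_matI) (simp_all add: coord_mat_def E(1) unit_fun_in)
    finally have ee: "e * e = e" by (rule h.mat_hom_inj)
    have "map_mat ?h (u ^\<^sub>m ?N) = coord_mat n (U ^^ ?N)"
      by (simp add: h.mat_hom_pow[OF u] hu coord_mat_funpow[OF Ulin UV])
    also have "\<dots> = map_mat ?h (1\<^sub>m n)"
    proof (rule eq_matI)
      fix i j assume "i < dim_row (map_mat ?h (1\<^sub>m n))" "j < dim_col (map_mat ?h (1\<^sub>m n))"
      then have ij: "i < n" "j < n" by simp_all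
      have "(U ^^ ?N) (unit_fun j) = unit_fun j"
        using E(2)[OF unit_fun_in[OF ij(2)]] unfolding U_def[abs_def] .
      then show "coord_mat n (U ^^ ?N) $$ (i, j) = map_mat ?h (1\<^sub>m n) $$ (i, j)"
        using ij by (simp add: coord_mat_def unit_fun_def del: One_nat_def)
    qed (simp_all add: coord_mat_def)
    finally have uN: "u ^\<^sub>m ?N = 1\<^sub>m n" by (rule h.mat_hom_inj)
    have uN': "u [^]\<^bsub>?R\<^esub> ?N = \<one>\<^bsub>?R\<^esub>"
      using uN pow_mat_ring_pow[OF u, of ?N "()"] by (simp add: ring_mat_simps)
    have uU: "u \<in> Units ?R"
      by (rule root_of_identity_in_Units[OF ring_mat _ _ uN']) (use u card in \<open>simp_all add: ring_mat_simps\<close>)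
    have "A = u + e" using A e by (intro eq_matI) (auto simp: u_def)
    then show "\<exists>u\<in>Units ?R. \<exists>e\<in>carrier ?R. u [^]\<^bsub>?R\<^esub> ?N = \<one>\<^bsub>?R\<^esub> \<and> e \<otimes>\<^bsub>?R\<^esub> e = e \<and> A = u \<oplus>\<^bsub>?R\<^esub> e"
      using uU uN' e ee by (intro bexI[of _ u] bexI[of _ e]) (auto simp: ring_mat_simps)
  qed
qed

lemma weakly_torsion_clean_exponent:
  assumes weak: "weakly_torsion_clean_prop (ring_mat TYPE('a::idom) n ()) k" and n: "n > 0" and k: "k > 0"
    and two: "(2::'a) \<noteq> 0" and card: "infinite (UNIV :: 'a set) \<or> card (UNIV :: 'a set) > 9"
  shows "finite (UNIV :: 'a set)" "card (UNIV :: 'a set) - 1 \<le> k"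
proof -
  let ?h = "to_fract :: 'a \<Rightarrow> 'a fract"
  note triple = weakly_torsion_clean_scalar[OF weak n]
  let ?H = "{x::'a. x ^ k = 1}"
  have "UNIV \<subseteq> ?H \<union> (\<lambda>x. x + 1) ` ?H \<union> (\<lambda>x. x - 1) ` ?H"
  proof
    fix a :: 'a
    have "a = (a - 1) + 1" "a = (a + 1) - 1" by simp_all
    then show "a \<in> ?H \<union> (\<lambda>x. x + 1) ` ?H \<union> (\<lambda>x. x - 1) ` ?H"
      using triple[of a] by blast
  qed
  then show fin: "finite (UNIV :: 'a set)"
    by (rule finite_subset) (simp add: card_roots_of_unity_le(1)[OF k])
  note surj = finite_idom_to_fract_surj[OF fin]
  note finF = card_fract_of_finite(1)[OF fin] and cardF = card_fract_of_finite(2)[OF fin]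
  note twoF = two_fract_neq_zero[OF two]
  interpret h: inj_comm_ring_hom ?h by unfold_locales auto
  have "x ^ k = 1 \<or> (x - 1) ^ k = 1 \<or> (x + 1) ^ k = 1" for x :: "'a fract"
  proof -
    obtain a where x: "x = ?h a" using surj by (metis surjD)
    have "?h (a ^ k) = 1 \<or> ?h ((a - 1) ^ k) = 1 \<or> ?h ((a + 1) ^ k) = 1"
      using triple[of a] by auto
    then show ?thesis by (simp add: x h.hom_power)
  qed
  then have "card (UNIV :: 'a fract set) - 1 \<le> k"
    by (intro triple_exponent_ge[OF finF twoF _ k]) (use card fin cardF in auto)
  then show "card (UNIV :: 'a set) - 1 \<le> k" by (simp add: cardF)
qed

lemma torsion_clean_prop_imp_weakly: "torsion_clean_prop S m \<Longrightarrow> weakly_torsion_clean_prop S m"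
  unfolding torsion_clean_prop_def weakly_torsion_clean_prop_def by blast

lemma torsion_clean_mat_iff:
  assumes n: "n > 0" and two: "(2::'a::idom) \<noteq> 0"
    and card: "infinite (UNIV :: 'a set) \<or> card (UNIV :: 'a set) > 9"
  shows "torsion_clean m (ring_mat TYPE('a) n ()) \<longleftrightarrow>
      finite (UNIV :: 'a set) \<and> m = card (UNIV :: 'a set) - 1" (is "?A \<longleftrightarrow> ?C")
    and "weakly_torsion_clean m (ring_mat TYPE('a) n ()) \<longleftrightarrow>
      finite (UNIV :: 'a set) \<and> m = card (UNIV :: 'a set) - 1" (is "?B \<longleftrightarrow> ?C")
proof -
  let ?R = "ring_mat TYPE('a) n ()" and ?N = "card (UNIV :: 'a set) - 1"
  have min: "finite (UNIV :: 'a set)" "?N \<le> k" if "weakly_torsion_clean_prop ?R k" "k > 0" for k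
    using weakly_torsion_clean_exponent[OF that(1) n that(2) two card] by auto
  have N: "torsion_clean_prop ?R ?N" "?N > 0" if "finite (UNIV :: 'a set)"
    using torsion_clean_prop_mat[OF that _ two] that card by auto
  show "?A \<longleftrightarrow> ?C"
  proof
    assume ?A
    then have A: "torsion_clean_prop ?R m" "m > 0" "\<And>k. k > 0 \<Longrightarrow> torsion_clean_prop ?R k \<Longrightarrow> m \<le> k"
      by (auto simp: torsion_clean_def)
    note m = min[OF torsion_clean_prop_imp_weakly[OF A(1)] A(2)]
    with A(3)[OF N(2,1)] show ?C by simp
  next
    assume ?C
    then show ?A using N min(2)[OF torsion_clean_prop_imp_weakly] by (auto simp: torsion_clean_def)
  qed
  show "?B \<longleftrightarrow> ?C"
  proof
    assume ?B
    then have B: "weakly_torsion_clean_prop ?R m" "m > 0"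
        "\<And>k. k > 0 \<Longrightarrow> weakly_torsion_clean_prop ?R k \<Longrightarrow> m \<le> k"
      by (auto simp: weakly_torsion_clean_def)
    note m = min[OF B(1,2)]
    with B(3)[OF N(2) torsion_clean_prop_imp_weakly[OF N(1)]] show ?C by simp
  next
    assume ?C
    then show ?B using N min(2) torsion_clean_prop_imp_weakly
      by (auto simp: weakly_torsion_clean_def)
  qed
qed

lemma two_neq_zero_of_CHAR:
  assumes "CHAR('a::idom) \<noteq> 2"
  shows "(2::'a) \<noteq> 0"
proof
  assume "(2::'a) = 0"
  then have "of_nat 2 = (0::'a)" by simp
  then have "CHAR('a) dvd 2" by (simp only: of_nat_eq_0_iff_char_dvd)
  then have "CHAR('a) \<le> 2" "CHAR('a) \<noteq> 0"
    using dvd_imp_le[of "CHAR('a)" 2] by (simp, metis dvd_0_left_iff zero_neq_numeral)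
  with assms have "CHAR('a) = 1" by linarith
  then have "of_nat 1 = (0::'a)" by (metis of_nat_CHAR)
  then show False by simp
qed

theorem theorem1p7:
  fixes p q \<alpha> :: nat
  assumes "prime p" and "odd p" and "q = p ^ \<alpha>"
    and "CHAR('a::idom) \<noteq> 2"
    and "infinite (UNIV :: 'a set) \<or> card (UNIV :: 'a set) > 9"
  shows
    "((\<forall>n>0. torsion_clean (q - 1) (ring_mat TYPE('a) n ())) \<longleftrightarrow>
      (\<exists>n>0. torsion_clean (q - 1) (ring_mat TYPE('a) n ()))) \<and>
     ((\<exists>n>0. torsion_clean (q - 1) (ring_mat TYPE('a) n ())) \<longleftrightarrow>
      (\<forall>n>0. weakly_torsion_clean (q - 1) (ring_mat TYPE('a) n ()))) \<and>
     ((\<forall>n>0. weakly_torsion_clean (q - 1) (ring_mat TYPE('a) n ())) \<longleftrightarrow>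
      (\<exists>n>0. weakly_torsion_clean (q - 1) (ring_mat TYPE('a) n ()))) \<and>
     ((\<exists>n>0. weakly_torsion_clean (q - 1) (ring_mat TYPE('a) n ())) \<longleftrightarrow>
      field (class_ring :: 'a ring) \<and> finite (UNIV :: 'a set) \<and> card (UNIV :: 'a set) = q)"
proof -
  have two: "(2::'a) \<noteq> 0" using assms(4) by (rule two_neq_zero_of_CHAR)
  have q: "q - 1 = card (UNIV :: 'a set) - 1 \<longleftrightarrow> card (UNIV :: 'a set) = q"
    if "finite (UNIV :: 'a set)"
    using that assms(5) by auto
  have iff: "torsion_clean (q - 1) (ring_mat TYPE('a) n ()) \<longleftrightarrow>
        finite (UNIV :: 'a set) \<and> card (UNIV :: 'a set) = q"
      "weakly_torsion_clean (q - 1) (ring_mat TYPE('a) n ()) \<longleftrightarrow>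
        finite (UNIV :: 'a set) \<and> card (UNIV :: 'a set) = q" if "n > 0" for n
    using torsion_clean_mat_iff[OF that two assms(5), of "q - 1"] q by blast+
  have one: "\<exists>n::nat. n > 0" by blast
  show ?thesis using iff one finite_idom_field[where 'a = 'a] by blast
qed

end
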